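(* Fix $Z\in(0,1)$, $\beta\le1/8$, and $u\in(0,Z/2]$. There exist two instances with $Z_k=Z$ and $1-J_{\mathrm{user}}(A_k)=u$, identical in the distribution of every observable quantity except the candidate agent's reward distribution under the failure-task distribution $\mathcal D_{F,k}$, such that in one (the improving instance) $J_{\mathrm{user}}(\widetilde A)-J_{\mathrm{user}}(A_k)=u/2$ and $D_R(\widetilde A;A_k)=0$, and in the other (the non-improving instance) $J_{\mathrm{user}}(\widetilde A)-J_{\mathrm{user}}(A_k)=-u/2$, and such that any level-$\beta$ validation procedure that validates the candidate in the improving instance with probability at least $1/2$, under any task-selection policy and any data-dependent stopping rule, satisfies $$\mathbb E_-[N_{\mathrm{eval}}]\ \ge\ \frac{Z}{10\,u},$$ where $N_{\mathrm{eval}}$ is the total number of candidate-agent runs and $\mathbb E_-$ is expectation under the non-improving instance.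
   Context: Tasks $\mathcal T_{\mathrm{user}}$ and outputs $\mathcal O$ are measurable spaces; an agent is a Markov kernel $A(\cdot\mid t)$ from tasks to outputs; reward $r(t,o)\in[0,1]$ and failure detector $\phi(t,o)\in\{0,1\}$ are measurable; $\mathcal D_{\mathrm{user}}$ is an agent-independent probability measure on tasks. $V(A,t)=\int r(t,o)A(do\mid t)$, $J_{\mathrm{user}}(A)=\mathbb E_{t\sim\mathcal D_{\mathrm{user}}}V(A,t)$, $\psi_A(t)=\int\phi(t,o)A(do\mid t)$, $Z_k=\mathbb E_{\mathcal D_{\mathrm{user}}}\psi_{A_k}\in(0,1)$, $\mathcal D_{F,k}(dt)=\frac{\psi_{A_k}(t)}{Z_k}\mathcal D_{\mathrm{user}}(dt)$, $\mathcal D_{R,k}(dt)=\frac{1-\psi_{A_k}(t)}{1-Z_k}\mathcal D_{\mathrm{user}}(dt)$, $D_R(\widetilde A;A_k)=\mathbb E_{t\sim\mathcal D_{R,k}}|V(\widetilde A,t)-V(A_k,t)|$. An *instance* consists of a task space with distribution $\mathcal D_{\mathrm{user}}$, reward, failure detector, current agent $A_k$ and candidate agent $\widetilde A$, together with the available evaluation data: (1) an observed task stream, stationary ergodic and $\beta$-mixing with marginal $\mathcal D_{\mathrm{user}}$ (i.i.d. allowed), with current-agent outcomes $O_n\sim A_k(\cdot\mid T_n)$ that, given $T_n$, are conditionally independent of all other records and of fresh rollouts, and marks $\phi(T_n,O_n)$; (2) a stored reference sample of tasks with current-agent failure labels, separated from generation; (3) fresh rollouts of either agent on adaptively chosen tasks,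 each an independent draw from the agent's kernel at the chosen task returning a reward in $[0,1]$. A *validation procedure* chooses tasks and agents to run adaptively, stops according to a data-dependent rule, and outputs $\mathsf{validate}$ or $\mathsf{abstain}$; its task choices, statistics and stopping rule are measurable functions of the observations and its own instance-independent randomization. It has *level* $\beta$ if in every instance $\mathbb P[\mathsf{validate}\ \text{and}\ J_{\mathrm{user}}(\widetilde A)\le J_{\mathrm{user}}(A_k)]\le\beta$. $N_{\mathrm{eval}}$ counts the candidate agent's runs, each returning one task reward. *)

theory Defs
  imports "HOL-Probability.Probability"
begin

section \<open>Instances\<close>

datatype agent = Current | Candidate

text \<open>
  Throughout, \<open>TS\<close> and \<open>OS\<close> are the measurable spaces of tasks and of outputs (measures
  that serve only as carriers of their sigma-algebras), and \<open>m\<close> is the size of the stored reference sample. The last field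
  of an instance is the joint law of the tasks of the observed stream and of the tasks of the
  reference sample.
\<close>

record ('t, 'o) eval_instance =
  user_dist :: "'t measure"
  reward :: "'t \<Rightarrow> 'o \<Rightarrow> real"
  fails :: "'t \<Rightarrow> 'o \<Rightarrow> bool"
  kernel :: "agent \<Rightarrow> 't \<Rightarrow> 'o measure"
  task_law :: "((nat \<Rightarrow> 't) \<times> (nat \<Rightarrow> 't)) measure"

definition task_value :: "('t, 'o) eval_instance \<Rightarrow> agent \<Rightarrow> 't \<Rightarrow> real" where
  "task_value I a t = (\<integral>y. reward I t y \<partial>kernel I a t)"

definition J_user :: "('t, 'o) eval_instance \<Rightarrow> agent \<Rightarrow> real" where
  "J_user I a = (\<integral>t. task_value I a t \<partial>user_dist I)"

definition fail_prob :: "('t, 'o) eval_instance \<Rightarrow> 't \<Rightarrow> real" where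
  "fail_prob I t = (\<integral>y. of_bool (fails I t y) \<partial>kernel I Current t)"

definition fail_mass :: "('t, 'o) eval_instance \<Rightarrow> real" where
  "fail_mass I = (\<integral>t. fail_prob I t \<partial>user_dist I)"

definition retained_dist :: "('t, 'o) eval_instance \<Rightarrow> 't measure" where
  "retained_dist I =
     density (user_dist I) (\<lambda>t. ennreal ((1 - fail_prob I t) / (1 - fail_mass I)))"

definition regression :: "('t, 'o) eval_instance \<Rightarrow> real" where
  "regression I =
     (\<integral>t. \<bar>task_value I Candidate t - task_value I Current t\<bar> \<partial>retained_dist I)"

definition reward_law :: "('t, 'o) eval_instance \<Rightarrow> agent \<Rightarrow> 't \<Rightarrow> real measure" where
  "reward_law I a t = distr (kernel I a t) borel (reward I t)"


subsection \<open>Task streams\<close>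

abbreviation stream_space_of :: "'t measure \<Rightarrow> (nat \<Rightarrow> 't) measure" where
  "stream_space_of TS \<equiv> \<Pi>\<^sub>M i\<in>UNIV. TS"

definition shift :: "nat \<Rightarrow> (nat \<Rightarrow> 't) \<Rightarrow> nat \<Rightarrow> 't" where
  "shift k s = (\<lambda>i. s (k + i))"

definition stationary :: "'t measure \<Rightarrow> (nat \<Rightarrow> 't) measure \<Rightarrow> bool" where
  "stationary TS S \<longleftrightarrow> distr S (stream_space_of TS) (shift 1) = S"

definition ergodic :: "(nat \<Rightarrow> 't) measure \<Rightarrow> bool" where
  "ergodic S \<longleftrightarrow>
     (\<forall>A\<in>sets S. shift 1 -` A \<inter> space S = A \<longrightarrow> measure S A = 0 \<or> measure S A = 1)"

text \<open>
  The absolute-regularity coefficient of the sigma-algebras generated by times \<open>\<le> k\<close> and by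
  times \<open>\<ge> k + n\<close>, as the total variation distance between the joint law of past and future
  and the product of their laws.
\<close>

definition beta_coeff :: "'t measure \<Rightarrow> (nat \<Rightarrow> 't) measure \<Rightarrow> nat \<Rightarrow> real" where
  "beta_coeff TS S n = (SUP k.
     let past = (\<lambda>s. restrict s {..k});
         PS = (\<Pi>\<^sub>M i\<in>{..k}. TS);
         FS = stream_space_of TS;
         joint = distr S (PS \<Otimes>\<^sub>M FS) (\<lambda>s. (past s, shift (k + n) s));
         indep = distr S PS past \<Otimes>\<^sub>M distr S FS (shift (k + n))
     in SUP C\<in>sets (PS \<Otimes>\<^sub>M FS). \<bar>measure joint C - measure indep C\<bar>)"

definition beta_mixing :: "'t measure \<Rightarrow> (nat \<Rightarrow> 't) measure \<Rightarrow> bool" where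
  "beta_mixing TS S \<longleftrightarrow> beta_coeff TS S \<longlonglongrightarrow> 0"

definition valid_instance ::
  "'t measure \<Rightarrow> 'o measure \<Rightarrow> nat \<Rightarrow> ('t, 'o) eval_instance \<Rightarrow> bool" where
  "valid_instance TS OS m I \<longleftrightarrow>
     prob_space (user_dist I) \<and> sets (user_dist I) = sets TS \<and>
     (\<lambda>(t, y). reward I t y) \<in> borel_measurable (TS \<Otimes>\<^sub>M OS) \<and>
     (\<forall>t\<in>space TS. \<forall>y\<in>space OS. reward I t y \<in> {0..1}) \<and>
     Measurable.pred (TS \<Otimes>\<^sub>M OS) (\<lambda>(t, y). fails I t y) \<and>
     (\<forall>a. kernel I a \<in> TS \<rightarrow>\<^sub>M prob_algebra OS) \<and>
     fail_mass I \<in> {0<..<1} \<and>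
     prob_space (task_law I) \<and>
     sets (task_law I) = sets (stream_space_of TS \<Otimes>\<^sub>M (\<Pi>\<^sub>M i\<in>{..<m}. TS)) \<and>
     (let S = distr (task_law I) (stream_space_of TS) fst
      in (\<forall>n. distr S TS (\<lambda>s. s n) = user_dist I) \<and>
         stationary TS S \<and> ergodic S \<and> beta_mixing TS S)"


subsection \<open>Observed data\<close>

text \<open>
  A stream record consists of the task, the current agent's output and the failure mark; a
  reference record consists of the task and a failure label.
\<close>

type_synonym ('t, 'o) eval_data = "(nat \<Rightarrow> 't \<times> 'o \<times> bool) \<times> (nat \<Rightarrow> 't \<times> bool)"

definition data_space :: "'t measure \<Rightarrow> 'o measure \<Rightarrow> nat \<Rightarrow> ('t, 'o) eval_data measure" where
  "data_space TS OS m =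
     (\<Pi>\<^sub>M i\<in>UNIV. TS \<Otimes>\<^sub>M OS \<Otimes>\<^sub>M count_space UNIV) \<Otimes>\<^sub>M (\<Pi>\<^sub>M i\<in>{..<m}. TS \<Otimes>\<^sub>M count_space UNIV)"

text \<open>Given all tasks, the current-agent outputs behind the records are independent.\<close>

definition data_law ::
  "'t measure \<Rightarrow> 'o measure \<Rightarrow> nat \<Rightarrow> ('t, 'o) eval_instance \<Rightarrow> ('t, 'o) eval_data measure" where
  "data_law TS OS m I = task_law I \<bind> (\<lambda>(s, q).
     distr ((\<Pi>\<^sub>M n\<in>UNIV. kernel I Current (s n)) \<Otimes>\<^sub>M (\<Pi>\<^sub>M i\<in>{..<m}. kernel I Current (q i)))
       (data_space TS OS m)
       (\<lambda>(y, z). (\<lambda>n. (s n, y n, fails I (s n) (y n)), \<lambda>i\<in>{..<m}. (q i, fails I (q i) (z i)))))"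


section \<open>Validation procedures\<close>

text \<open>
  Before its rollout number \<open>n\<close> (counted from 0, over both agents) a procedure knows the
  recorded data, its own randomization, and the rewards of rollouts \<open>0, \<dots>, n - 1\<close>; the
  agents and tasks of the earlier rollouts are functions of these. It then either stops,
  validating if \<open>accepts\<close> holds and abstaining otherwise, or runs agent \<open>run_agent\<close> on task
  \<open>run_task\<close>. It has access to the whole recorded stream from the start, which includes the
  procedures that read the stream progressively.
\<close>

type_synonym ('t, 'o) history = "(('t, 'o) eval_data \<times> real) \<times> (nat \<Rightarrow> real)"

record ('t, 'o) procedure =
  seed_law :: "real measure"
  stops :: "nat \<Rightarrow> ('t, 'o) history \<Rightarrow> bool"
  accepts :: "nat \<Rightarrow> ('t, 'o) history \<Rightarrow> bool"
  run_agent :: "nat \<Rightarrow> ('t, 'o) history \<Rightarrow> agent"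
  run_task :: "nat \<Rightarrow> ('t, 'o) history \<Rightarrow> 't"

definition history_space ::
  "'t measure \<Rightarrow> 'o measure \<Rightarrow> nat \<Rightarrow> ('t, 'o) procedure \<Rightarrow> nat \<Rightarrow> ('t, 'o) history measure" where
  "history_space TS OS m \<pi> n =
     (data_space TS OS m \<Otimes>\<^sub>M seed_law \<pi>) \<Otimes>\<^sub>M (\<Pi>\<^sub>M i\<in>{0..<n}. borel)"

definition valid_procedure ::
  "'t measure \<Rightarrow> 'o measure \<Rightarrow> nat \<Rightarrow> ('t, 'o) procedure \<Rightarrow> bool" where
  "valid_procedure TS OS m \<pi> \<longleftrightarrow>
     prob_space (seed_law \<pi>) \<and>
     (\<forall>n. Measurable.pred (history_space TS OS m \<pi> n) (stops \<pi> n) \<and>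
          Measurable.pred (history_space TS OS m \<pi> n) (accepts \<pi> n) \<and>
          run_agent \<pi> n \<in> history_space TS OS m \<pi> n \<rightarrow>\<^sub>M count_space UNIV \<and>
          run_task \<pi> n \<in> history_space TS OS m \<pi> n \<rightarrow>\<^sub>M TS)"

text \<open>
  The law of the reward sequence given data and randomization, by the Ionescu-Tulcea theorem.
  The sequence is continued formally after the procedure has stopped; this affects neither
  the decision nor the number of runs defined below.
\<close>

definition rollout_law ::
  "('t, 'o) eval_instance \<Rightarrow> ('t, 'o) procedure \<Rightarrow> ('t, 'o) eval_data \<times> real \<Rightarrow> (nat \<Rightarrow> real) measure" where
  "rollout_law I \<pi> x =
     (let K = (\<lambda>n h. reward_law I (run_agent \<pi> n (x, h)) (run_task \<pi> n (x, h)))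
      in projective_family.lim UNIV (Ionescu_Tulcea.CI K (\<lambda>_. borel)) (\<lambda>_. borel))"

definition run_law ::
  "'t measure \<Rightarrow> 'o measure \<Rightarrow> nat \<Rightarrow> ('t, 'o) eval_instance \<Rightarrow> ('t, 'o) procedure \<Rightarrow>
     ('t, 'o) history measure" where
  "run_law TS OS m I \<pi> = (data_law TS OS m I \<Otimes>\<^sub>M seed_law \<pi>) \<bind> (\<lambda>x.
     distr (rollout_law I \<pi> x)
       ((data_space TS OS m \<Otimes>\<^sub>M seed_law \<pi>) \<Otimes>\<^sub>M (\<Pi>\<^sub>M i\<in>UNIV. borel)) (\<lambda>r. (x, r)))"

definition history_at :: "nat \<Rightarrow> ('t, 'o) history \<Rightarrow> ('t, 'o) history" where
  "history_at n \<omega> = (fst \<omega>, restrict (snd \<omega>) {0..<n})"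

definition validates :: "('t, 'o) procedure \<Rightarrow> ('t, 'o) history \<Rightarrow> bool" where
  "validates \<pi> \<omega> \<longleftrightarrow> (\<exists>n. (\<forall>k<n. \<not> stops \<pi> k (history_at k \<omega>)) \<and>
     stops \<pi> n (history_at n \<omega>) \<and> accepts \<pi> n (history_at n \<omega>))"

definition N_eval :: "('t, 'o) procedure \<Rightarrow> ('t, 'o) history \<Rightarrow> ennreal" where
  "N_eval \<pi> \<omega> = (\<Sum>n. of_bool ((\<forall>k\<le>n. \<not> stops \<pi> k (history_at k \<omega>)) \<and>
     run_agent \<pi> n (history_at n \<omega>) = Candidate))"

definition has_level ::
  "'t measure \<Rightarrow> 'o measure \<Rightarrow> nat \<Rightarrow> ('t, 'o) procedure \<Rightarrow> real \<Rightarrow> bool" where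
  "has_level TS OS m \<pi> \<beta> \<longleftrightarrow> (\<forall>I. valid_instance TS OS m I \<longrightarrow>
     \<P>(\<omega> in run_law TS OS m I \<pi>. validates \<pi> \<omega> \<and> J_user I Candidate \<le> J_user I Current) \<le> \<beta>)"


section \<open>Indistinguishability outside the failure tasks\<close>

text \<open>
  Equality in law of everything observable, except for the candidate's rewards on tasks with
  failure probability 1. These tasks form a null set of \<open>retained_dist\<close>, so the candidate's
  rewards can differ only under the failure-task distribution, whose density with respect to
  \<open>user_dist\<close> is \<open>fail_prob / fail_mass\<close>. The condition is imposed pointwise and not almost
  everywhere because a procedure may run an agent on any task of its choice.
\<close>

definition same_except_candidate_on_failures ::
  "'t measure \<Rightarrow> 'o measure \<Rightarrow> nat \<Rightarrow> ('t, 'o) eval_instance \<Rightarrow> ('t, 'o) eval_instance \<Rightarrow> bool" where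
  "same_except_candidate_on_failures TS OS m I I' \<longleftrightarrow>
     user_dist I = user_dist I' \<and>
     data_law TS OS m I = data_law TS OS m I' \<and>
     (\<forall>t\<in>space TS.
        fail_prob I t = fail_prob I' t \<and>
        reward_law I Current t = reward_law I' Current t \<and>
        (fail_prob I t < 1 \<longrightarrow> reward_law I Candidate t = reward_law I' Candidate t))"

end

theory Submission
  imports Defs
begin

text \<open>
  The two instances differ only in the reward law of the candidate on the failure task, which is
  a Bernoulli law with success probability \<open>1 - u / (2 Z)\<close> or \<open>1 - 3 u / (2 Z)\<close>; these laws
  are at total variation distance \<open>u / Z\<close>. Exchanging the kernels one rollout at a time, each
  candidate run before the stopping time changes the probability of validating by at most
  \<open>u / Z\<close>, so the two probabilities of validating differ by at most \<open>u / Z\<close> times the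
  expected number of candidate runs in the non-improving instance. As they are at least \<open>1 / 2\<close>
  and at most \<open>1 / 8\<close>, that number is at least \<open>3 Z / (8 u)\<close>.
\<close>

section \<open>Ionescu-Tulcea measures depending on a parameter\<close>

text \<open>The exchange runs through hybrids that use the non-improving kernels before rollout
  \<open>k\<close> and the improving ones from \<open>k\<close> on. Between neighbouring hybrids,
  rollout \<open>k\<close> is changed on histories drawn from the non-improving instance; this is
  why the runs end up counted under that instance and not under the other. A bound linear in total
  variation is crude for nearly fair coins, where detecting a gap \<open>d\<close> takes about
  \<open>1 / d^2\<close> runs. Here the rates of lost reward are \<open>u / (2 * Z)\<close> and
  \<open>3 * u / (2 * Z)\<close>, both of the order of their difference, so a linear bound has the
  right order. Two obstacles shape the proof. A run is a mixture, over data and seed, of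
  Ionescu-Tulcea limits, so these limits must depend measurably on a parameter. Moreover the
  procedure may never stop and the expected number of runs may be infinite; the comparison is
  therefore made in \<open>ennreal\<close> at a finite horizon and then passed to the limit.\<close>

lemma (in Ionescu_Tulcea) prob_space_lim: "prob_space PF.lim"
proof (rule prob_space_distrD)
  show "(\<lambda>h. restrict h {}) \<in> PF.lim \<rightarrow>\<^sub>M PiM {} M"
    by (simp add: measurable_cong_sets[OF PF.sets_lim refl] measurable_restrict_subset del: PiM_empty)
  show "prob_space (distr PF.lim (PiM {} M) (\<lambda>h. restrict h {}))"
    by (subst distr_lim) (auto intro: PF.prob_space_P)
qed

text \<open>Moves an integrand that reads only the first \<open>n\<close> coordinates from the
  projective limit to the finite composition \<open>C 0 n\<close>, which has a recursion in
  \<open>n\<close> and so admits induction.\<close>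

lemma (in Ionescu_Tulcea) nn_integral_lim_restrict:
  assumes f: "f \<in> borel_measurable (PiM {0..<n} M)"
  shows "(\<integral>\<^sup>+r. f (restrict r {0..<n}) \<partial>PF.lim) = (\<integral>\<^sup>+h. f h \<partial>C 0 n (\<lambda>_. undefined))"
proof -
  have sets: "sets (C 0 n (\<lambda>_. undefined)) = sets (PiM {0..<n} M)"
    by (simp add: sets_C)
  have "CI {0..<n} = C 0 n (\<lambda>_. undefined)"
  proof (rule measure_eqI)
    show "sets (CI {0..<n}) = sets (C 0 n (\<lambda>_. undefined))"
      by (simp add: sets CI_def)
    fix X assume "X \<in> sets (CI {0..<n})"
    then have "X \<in> sets (PiM {0..<n} M)"
      by (simp add: CI_def)
    then show "emeasure (CI {0..<n}) X = emeasure (C 0 n (\<lambda>_. undefined)) X"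
      using sets.sets_into_space[of X "PiM {0..<n} M"]
      by (subst emeasure_CI[of _ n]) (simp_all add: prod_emb_id space_PiM)
  qed
  then have "distr PF.lim (PiM {0..<n} M) (\<lambda>r. restrict r {0..<n}) = C 0 n (\<lambda>_. undefined)"
    by (simp add: distr_lim)
  moreover have "(\<integral>\<^sup>+h. f h \<partial>distr PF.lim (PiM {0..<n} M) (\<lambda>r. restrict r {0..<n})) =
      (\<integral>\<^sup>+r. f (restrict r {0..<n}) \<partial>PF.lim)"
    by (rule nn_integral_distr)
       (auto simp: f measurable_cong_sets[OF PF.sets_lim refl] intro: measurable_restrict_subset)
  ultimately show ?thesis by simp
qed

text \<open>Here \<open>x\<close> will be the recorded data together with the seed. Measurability is
  required jointly in \<open>x\<close> and the history, so that the law of the whole sequence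
  becomes a kernel in \<open>x\<close> that can be integrated.\<close>

locale parametric_kernels =
  fixes X :: "'x measure" and P :: "nat \<Rightarrow> 'x \<times> (nat \<Rightarrow> 'a) \<Rightarrow> 'a measure" and M :: "nat \<Rightarrow> 'a measure"
  assumes P[measurable]: "\<And>n. P n \<in> X \<Otimes>\<^sub>M PiM {0..<n} M \<rightarrow>\<^sub>M prob_algebra (M n)"
begin

lemma Ionescu_Tulcea:
  assumes "x \<in> space X"
  shows "Ionescu_Tulcea (\<lambda>n h. P n (x, h)) M"
proof (rule Ionescu_Tulcea.intro)
  note assms[measurable]
  show "(\<lambda>h. P n (x, h)) \<in> PiM {0..<n} M \<rightarrow>\<^sub>M subprob_algebra (M n)" for n
    by (rule measurable_prob_algebraD) measurable
  show "prob_space (P n (x, h))" if "h \<in> space (PiM {0..<n} M)" for n h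
    using measurable_space[OF P, of "(x, h)" n] assms that
    by (simp add: space_pair_measure space_prob_algebra)
qed

lemma measurable_C:
  "(\<lambda>x. Ionescu_Tulcea.C (\<lambda>n h. P n (x, h)) M 0 n (\<lambda>_. undefined))
     \<in> X \<rightarrow>\<^sub>M prob_algebra (PiM {0..<n} M)"
proof (induction n)
  case 0
  have "(\<lambda>x. return (PiM {0..<0} M) (\<lambda>_. undefined)) \<in> X \<rightarrow>\<^sub>M prob_algebra (PiM {0..<0} M)"
    by (rule measurable_const) (simp add: space_prob_algebra prob_space_return space_PiM)
  then show ?case
    by (rule measurable_cong[THEN iffD1, rotated]) (simp add: Ionescu_Tulcea.C.simps[OF Ionescu_Tulcea])
next
  case (Suc n)
  have upd: "(\<lambda>(z, y). (snd z)(n := y))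
      \<in> (X \<Otimes>\<^sub>M PiM {0..<n} M) \<Otimes>\<^sub>M M n \<rightarrow>\<^sub>M PiM {0..<Suc n} M"
    unfolding split_beta'
    by (rule measurable_fun_upd[where J="{0..<n}"]) auto
  have "(\<lambda>z. distr (P n z) (PiM {0..<Suc n} M) (fun_upd (snd z) n))
      \<in> X \<Otimes>\<^sub>M PiM {0..<n} M \<rightarrow>\<^sub>M prob_algebra (PiM {0..<Suc n} M)"
    by (rule measurable_distr_prob_space2[OF P upd])
  then have "(\<lambda>x. Ionescu_Tulcea.C (\<lambda>n h. P n (x, h)) M 0 n (\<lambda>_. undefined) \<bind>
       (\<lambda>h. distr (P n (x, h)) (PiM {0..<Suc n} M) (fun_upd h n)))
     \<in> X \<rightarrow>\<^sub>M prob_algebra (PiM {0..<Suc n} M)"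
    by (intro measurable_bind_prob_space2[OF Suc]) (simp add: split_beta')
  then show ?case
  proof (rule measurable_cong[THEN iffD1, rotated])
    fix x assume "x \<in> space X"
    then interpret Ionescu_Tulcea "\<lambda>n h. P n (x, h)" M
      by (rule Ionescu_Tulcea)
    show "C 0 n (\<lambda>_. undefined) \<bind> (\<lambda>h. distr (P n (x, h)) (PiM {0..<Suc n} M) (fun_upd h n)) =
        C 0 (Suc n) (\<lambda>_. undefined)"
      by (simp add: eP_def[abs_def])
  qed
qed

text \<open>Measurability into the space of probability measures can be tested on an
  intersection-stable generator. For a cylinder over finitely many coordinates the limit agrees with
  some \<open>C 0 n\<close>, whose measurability in \<open>x\<close> is known.\<close>

lemma measurable_lim:
  "(\<lambda>x. projective_family.lim UNIV (Ionescu_Tulcea.CI (\<lambda>n h. P n (x, h)) M) M)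
     \<in> X \<rightarrow>\<^sub>M prob_algebra (PiM UNIV M)" (is "?L \<in> _")
proof (rule measurable_prob_algebra_generated[OF sets_PiM Int_stable_prod_algebra prod_algebra_sets_into_space])
  fix x assume "x \<in> space X"
  then interpret Ionescu_Tulcea "\<lambda>n h. P n (x, h)" M
    by (rule Ionescu_Tulcea)
  show "prob_space (?L x)" "sets (?L x) = sets (PiM UNIV M)"
    by (simp_all add: prob_space_lim)
next
  fix A assume "A \<in> prod_algebra UNIV M"
  then obtain J E where J: "finite J" "A = prod_emb UNIV M J (Pi\<^sub>E J E)" "\<And>i. i \<in> J \<Longrightarrow> E i \<in> sets (M i)"
    by (elim prod_algebraE) blast
  then have E: "Pi\<^sub>E J E \<in> sets (PiM J M)"
    by (intro sets_PiM_I_finite) auto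
  \<comment> \<open>\<open>insert 0\<close> gives \<open>Max\<close> a nonempty argument when
    \<open>J\<close> is empty.\<close>
  define n where "n = Suc (Max (insert 0 J))"
  have n: "J \<subseteq> {0..<n}"
    using J(1) by (auto simp: n_def less_Suc_eq_le)
  have "(\<lambda>x. emeasure (Ionescu_Tulcea.C (\<lambda>n h. P n (x, h)) M 0 n (\<lambda>_. undefined))
      (prod_emb {0..<n} M J (Pi\<^sub>E J E))) \<in> borel_measurable X"
    using n E
    by (intro measurable_compose[OF measurable_prob_algebraD[OF measurable_C] measurable_emeasure_subprob_algebra])
       (auto intro: measurable_prod_emb)
  then show "(\<lambda>x. emeasure (?L x) A) \<in> borel_measurable X"
  proof (rule measurable_cong[THEN iffD1, rotated])
    fix x assume "x \<in> space X"
    then interpret Ionescu_Tulcea "\<lambda>n h. P n (x, h)" M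
      by (rule Ionescu_Tulcea)
    show "emeasure (Ionescu_Tulcea.C (\<lambda>n h. P n (x, h)) M 0 n (\<lambda>_. undefined))
        (prod_emb {0..<n} M J (Pi\<^sub>E J E)) = emeasure (?L x) A"
      using emeasure_CI[OF n E] lim[OF J(1) E] J(2) by simp
  qed
qed

end

section \<open>Change of kernels up to a stopping time\<close>

text \<open>The test at \<open>n\<close> itself is included: this is the event that rollout
  \<open>n\<close> really takes place.\<close>

definition running :: "(nat \<Rightarrow> (nat \<Rightarrow> 'a) \<Rightarrow> bool) \<Rightarrow> nat \<Rightarrow> (nat \<Rightarrow> 'a) \<Rightarrow> bool" where
  "running stop n h \<longleftrightarrow> (\<forall>k\<le>n. \<not> stop k (restrict h {0..<k}))"

text \<open>Pointwise version of measurability with respect to the stopped past, on the event of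
  having stopped before \<open>n\<close>. For \<open>k = n\<close> the condition would be vacuous,
  as two paths in the product space with equal restrictions to \<open>{0..<n}\<close>
  coincide.\<close>

definition determined_when_stopped ::
  "(nat \<Rightarrow> 'a measure) \<Rightarrow> (nat \<Rightarrow> (nat \<Rightarrow> 'a) \<Rightarrow> bool) \<Rightarrow> nat \<Rightarrow> ((nat \<Rightarrow> 'a) \<Rightarrow> ennreal) \<Rightarrow> bool" where
  "determined_when_stopped M stop n f \<longleftrightarrow>
     (\<forall>h\<in>space (PiM {0..<n} M). \<forall>h'\<in>space (PiM {0..<n} M). \<forall>k<n.
        restrict h {0..<k} = restrict h' {0..<k} \<longrightarrow> stop k (restrict h {0..<k}) \<longrightarrow> f h = f h')"

lemma pred_running[measurable]:
  fixes M :: "nat \<Rightarrow> 'a measure"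
  assumes [measurable]: "\<And>k. Measurable.pred (PiM {0..<k} M) (stop k)"
    and "{0..<n} \<subseteq> I"
  shows "Measurable.pred (PiM I M) (running stop n)"
proof -
  have [measurable]: "(\<lambda>h. restrict h {0..<k}) \<in> PiM I M \<rightarrow>\<^sub>M PiM {0..<k} M" if "k \<le> n" for k
    using that assms(2) by (intro measurable_restrict_subset) auto
  have "Measurable.pred (PiM I M) (\<lambda>h. \<forall>k\<in>{..n}. \<not> stop k (restrict h {0..<k}))"
    by (intro pred_intros_finite pred_intros_logic measurable_compose[OF _ assms(1)]) auto
  then show ?thesis
    by (simp add: running_def[abs_def])
qed

lemma (in Ionescu_Tulcea) space_fun_upd:
  "h \<in> space (PiM {0..<n} M) \<Longrightarrow> y \<in> space (M n) \<Longrightarrow> h(n := y) \<in> space (PiM {0..<Suc n} M)"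
  by (auto simp: space_PiM PiE_iff extensional_def)

lemma (in Ionescu_Tulcea) nn_integral_C_Suc:
  assumes f: "f \<in> borel_measurable (PiM {0..<Suc n} M)"
  shows "(\<integral>\<^sup>+h. f h \<partial>C 0 (Suc n) (\<lambda>_. undefined)) =
    (\<integral>\<^sup>+h. \<integral>\<^sup>+y. f (h(n := y)) \<partial>P n h \<partial>C 0 n (\<lambda>_. undefined))"
proof -
  have "eP n \<in> C 0 n (\<lambda>_. undefined) \<rightarrow>\<^sub>M subprob_algebra (PiM {0..<Suc n} M)"
    using measurable_eP by (simp cong: measurable_cong_sets add: measurable_cong_sets[OF sets_C refl])
  then have "(\<integral>\<^sup>+h. f h \<partial>C 0 (Suc n) (\<lambda>_. undefined)) =
      (\<integral>\<^sup>+h. \<integral>\<^sup>+h'. f h' \<partial>eP n h \<partial>C 0 n (\<lambda>_. undefined))"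
    using f by (simp add: nn_integral_bind)
  also have "\<dots> = (\<integral>\<^sup>+h. \<integral>\<^sup>+y. f (h(n := y)) \<partial>P n h \<partial>C 0 n (\<lambda>_. undefined))"
    by (intro nn_integral_cong nn_integral_eP f) (simp add: space_C)
  finally show ?thesis .
qed

lemma (in Ionescu_Tulcea) borel_measurable_next_integral:
  assumes [measurable]: "f \<in> borel_measurable (PiM {0..<Suc n} M)"
  shows "(\<lambda>h. \<integral>\<^sup>+y. f (h(n := y)) \<partial>P n h) \<in> borel_measurable (PiM {0..<n} M)"
proof (rule nn_integral_measurable_subprob_algebra2[OF _ P])
  have "(\<lambda>z. (fst z)(n := snd z)) \<in> PiM {0..<n} M \<Otimes>\<^sub>M M n \<rightarrow>\<^sub>M PiM {0..<Suc n} M"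
    by (rule measurable_fun_upd[where J="{0..<n}"]) auto
  from measurable_compose[OF this assms]
  show "(\<lambda>(h, y). f (h(n := y))) \<in> borel_measurable (PiM {0..<n} M \<Otimes>\<^sub>M M n)"
    by (simp add: split_beta')
qed

lemma restrict_fun_upd_atLeast0:
  fixes h :: "nat \<Rightarrow> 'a"
  shows "k \<le> n \<Longrightarrow> restrict (h(n := y)) {0..<k} = restrict h {0..<k}"
  by (auto simp: restrict_def fun_eq_iff)

text \<open>
  The kernels are exchanged one step at a time from the last to the first. After stopping, \<open>f\<close>
  ignores the new coordinates, so no cost is incurred there.
\<close>

lemma nn_integral_C_le_add_cost:
  fixes M :: "nat \<Rightarrow> 'a measure" and f :: "(nat \<Rightarrow> 'a) \<Rightarrow> ennreal"
  assumes "Ionescu_Tulcea P M" and "Ionescu_Tulcea Q M"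
    and stop[measurable]: "\<And>n. Measurable.pred (PiM {0..<n} M) (stop n)"
    and cost[measurable]: "\<And>n. cost n \<in> borel_measurable (PiM {0..<n} M)"
    and step: "\<And>n h g. h \<in> space (PiM {0..<n} M) \<Longrightarrow> g \<in> borel_measurable (M n) \<Longrightarrow>
      (\<And>y. y \<in> space (M n) \<Longrightarrow> g y \<le> 1) \<Longrightarrow>
      (\<integral>\<^sup>+y. g y \<partial>P n h) \<le> (\<integral>\<^sup>+y. g y \<partial>Q n h) + cost n h"
    and "f \<in> borel_measurable (PiM {0..<n} M)"
    and "\<And>h. h \<in> space (PiM {0..<n} M) \<Longrightarrow> f h \<le> 1"
    and "determined_when_stopped M stop n f"
  shows "(\<integral>\<^sup>+h. f h \<partial>Ionescu_Tulcea.C P M 0 n (\<lambda>_. undefined)) \<le>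
    (\<integral>\<^sup>+h. f h \<partial>Ionescu_Tulcea.C Q M 0 n (\<lambda>_. undefined)) +
    (\<Sum>k<n. \<integral>\<^sup>+h. cost k h * of_bool (running stop k h) \<partial>Ionescu_Tulcea.C Q M 0 k (\<lambda>_. undefined))"
  using assms(6-)
proof (induction n arbitrary: f)
  interpret P: Ionescu_Tulcea P M by fact
  interpret Q: Ionescu_Tulcea Q M by fact
  {
    case 0
    then show ?case
      by (simp add: P.C.simps Q.C.simps)
  next
    case (Suc n f)
    note f[measurable] = Suc.prems(1) and f_le = Suc.prems(2)
    \<comment> \<open>The range includes \<open>k = n\<close>: a stop immediately before the last
      coordinate is drawn also freezes \<open>f\<close>.\<close>
    have f_eq: "f h = f h'"
      if "h \<in> space (PiM {0..<Suc n} M)" "h' \<in> space (PiM {0..<Suc n} M)" "k \<le> n"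
        "restrict h {0..<k} = restrict h' {0..<k}" "stop k (restrict h {0..<k})" for h h' k
      using Suc.prems(3) that unfolding determined_when_stopped_def by (meson less_Suc_eq_le)
    define gP where "gP h = (\<integral>\<^sup>+y. f (h(n := y)) \<partial>P n h)" for h
    define gQ where "gQ h = (\<integral>\<^sup>+y. f (h(n := y)) \<partial>Q n h)" for h
    have [measurable]: "gP \<in> borel_measurable (PiM {0..<n} M)" "gQ \<in> borel_measurable (PiM {0..<n} M)"
      unfolding gP_def gQ_def
      by (intro P.borel_measurable_next_integral Q.borel_measurable_next_integral f)+
    have gP_const: "gP h = c"
      if h: "h \<in> space (PiM {0..<n} M)" and c: "\<And>y. y \<in> space (M n) \<Longrightarrow> f (h(n := y)) = c" for h c
    proof -
      interpret prob_space "P n h" by (rule P.prob_space_P[OF h])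
      have "gP h = (\<integral>\<^sup>+y. c \<partial>P n h)"
        unfolding gP_def by (intro nn_integral_cong c) (simp add: P.space_P[OF h])
      then show ?thesis by (simp add: emeasure_space_1)
    qed
    have gQ_const: "gQ h = c"
      if h: "h \<in> space (PiM {0..<n} M)" and c: "\<And>y. y \<in> space (M n) \<Longrightarrow> f (h(n := y)) = c" for h c
    proof -
      interpret prob_space "Q n h" by (rule Q.prob_space_P[OF h])
      have "gQ h = (\<integral>\<^sup>+y. c \<partial>Q n h)"
        unfolding gQ_def by (intro nn_integral_cong c) (simp add: Q.space_P[OF h])
      then show ?thesis by (simp add: emeasure_space_1)
    qed
    obtain y0 where y0: "y0 \<in> space (M n)"
      using P.non_empty[of n] by blast
    have "gP h \<le> 1" if h: "h \<in> space (PiM {0..<n} M)" for h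
    proof -
      interpret prob_space "P n h" by (rule P.prob_space_P[OF h])
      have "gP h \<le> (\<integral>\<^sup>+y. 1 \<partial>P n h)"
        unfolding gP_def
        by (intro nn_integral_mono f_le P.space_fun_upd[OF h]) (simp add: P.space_P[OF h])
      then show ?thesis by (simp add: emeasure_space_1)
    qed
    \<comment> \<open>After a stop at \<open>k < n\<close> the values of \<open>f\<close> on all
      extensions of \<open>h\<close> and \<open>h'\<close> equal the single number
      \<open>f (h(n := y0))\<close>, so both averages do as well, although \<open>P n h\<close> and
      \<open>P n h'\<close> may differ.\<close>
    moreover have "determined_when_stopped M stop n gP"
      unfolding determined_when_stopped_def
    proof (intro ballI allI impI)
      fix h h' k
      assume h: "h \<in> space (PiM {0..<n} M)" "h' \<in> space (PiM {0..<n} M)" and k: "k < n"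
        "restrict h {0..<k} = restrict h' {0..<k}" "stop k (restrict h {0..<k})"
      have "f (h(n := y)) = f (h(n := y0))" "f (h'(n := y)) = f (h(n := y0))"
        if "y \<in> space (M n)" for y
        using h k y0 that
        by (auto intro!: f_eq[of _ _ k] P.space_fun_upd simp: restrict_fun_upd_atLeast0)
      then have "gP h = f (h(n := y0))" "gP h' = f (h(n := y0))"
        by (auto intro!: gP_const h)
      then show "gP h = gP h'" by simp
    qed
    ultimately have IH: "(\<integral>\<^sup>+h. gP h \<partial>P.C 0 n (\<lambda>_. undefined)) \<le> (\<integral>\<^sup>+h. gP h \<partial>Q.C 0 n (\<lambda>_. undefined)) +
        (\<Sum>k<n. \<integral>\<^sup>+h. cost k h * of_bool (running stop k h) \<partial>Q.C 0 k (\<lambda>_. undefined))"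
      by (intro Suc.IH) auto
    \<comment> \<open>If the process is still running, this is the one-step hypothesis. Otherwise
      \<open>f\<close> is constant in the last coordinate, and averaging it against either
      probability kernel gives the same value.\<close>
    have gP_le: "gP h \<le> gQ h + cost n h * of_bool (running stop n h)"
      if h: "h \<in> space (PiM {0..<n} M)" for h
    proof (cases "running stop n h")
      case True
      have "(\<lambda>y. h(n := y)) \<in> M n \<rightarrow>\<^sub>M PiM {0..<Suc n} M"
        using h by (intro measurable_fun_upd[where J="{0..<n}"]) auto
      then have "(\<lambda>y. f (h(n := y))) \<in> borel_measurable (M n)"
        by measurable
      then show ?thesis
        using step[OF h, of "\<lambda>y. f (h(n := y))"] f_le[OF P.space_fun_upd[OF h]] True
        unfolding gP_def gQ_def by simp
    next
      case False
      then obtain k where k: "k \<le> n" "stop k (restrict h {0..<k})"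
        by (auto simp: running_def)
      have "f (h(n := y)) = f (h(n := y0))" if "y \<in> space (M n)" for y
        using h k y0 that
        by (auto intro!: f_eq[of _ _ k] P.space_fun_upd simp: restrict_fun_upd_atLeast0)
      then have "gP h = f (h(n := y0))" "gQ h = f (h(n := y0))"
        by (auto intro!: gP_const[OF h] gQ_const[OF h])
      then show ?thesis by simp
    qed
    \<comment> \<open>The induction hypothesis is applied to \<open>gP\<close>, with the last kernel
      still \<open>P\<close>. When that kernel is replaced, the first \<open>n\<close> are already
      \<open>Q\<close>, so its cost is integrated against \<open>Q\<close>.\<close>
    have "(\<integral>\<^sup>+h. f h \<partial>P.C 0 (Suc n) (\<lambda>_. undefined)) = (\<integral>\<^sup>+h. gP h \<partial>P.C 0 n (\<lambda>_. undefined))"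
      unfolding gP_def by (rule P.nn_integral_C_Suc[OF f])
    also note IH
    also have "(\<integral>\<^sup>+h. gP h \<partial>Q.C 0 n (\<lambda>_. undefined)) \<le>
        (\<integral>\<^sup>+h. gQ h + cost n h * of_bool (running stop n h) \<partial>Q.C 0 n (\<lambda>_. undefined))"
      by (intro nn_integral_mono gP_le) (simp add: Q.space_C)
    also have "\<dots> = (\<integral>\<^sup>+h. gQ h \<partial>Q.C 0 n (\<lambda>_. undefined)) +
        (\<integral>\<^sup>+h. cost n h * of_bool (running stop n h) \<partial>Q.C 0 n (\<lambda>_. undefined))"
    proof (rule nn_integral_add)
      have [measurable]: "Measurable.pred (PiM {0..<n} M) (running stop n)"
        by (rule pred_running) auto
      have "(\<lambda>h. cost n h * of_bool (running stop n h)) \<in> borel_measurable (PiM {0..<n} M)"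
        by measurable
      then show "(\<lambda>h. cost n h * of_bool (running stop n h)) \<in> borel_measurable (Q.C 0 n (\<lambda>_. undefined))"
        by (simp add: measurable_cong_sets[OF Q.sets_C refl])
      show "gQ \<in> borel_measurable (Q.C 0 n (\<lambda>_. undefined))"
        by (simp add: measurable_cong_sets[OF Q.sets_C refl])
    qed
    also have "(\<integral>\<^sup>+h. gQ h \<partial>Q.C 0 n (\<lambda>_. undefined)) = (\<integral>\<^sup>+h. f h \<partial>Q.C 0 (Suc n) (\<lambda>_. undefined))"
      unfolding gQ_def by (rule Q.nn_integral_C_Suc[OF f, symmetric])
    finally show ?case
      by (simp add: ac_simps)
  }
qed

section \<open>Acceptance at the stopping time, and the infinite horizon\<close>

definition accepted ::
  "(nat \<Rightarrow> (nat \<Rightarrow> 'a) \<Rightarrow> bool) \<Rightarrow> (nat \<Rightarrow> (nat \<Rightarrow> 'a) \<Rightarrow> bool) \<Rightarrow> nat \<Rightarrow> (nat \<Rightarrow> 'a) \<Rightarrow> bool" where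
  "accepted stop acc n r \<longleftrightarrow> (\<forall>k<n. \<not> stop k (restrict r {0..<k})) \<and>
     stop n (restrict r {0..<n}) \<and> acc n (restrict r {0..<n})"

lemma pred_accepted[measurable]:
  fixes M :: "nat \<Rightarrow> 'a measure"
  assumes "\<And>k. Measurable.pred (PiM {0..<k} M) (stop k)"
    and "\<And>k. Measurable.pred (PiM {0..<k} M) (acc k)" and "{0..<n} \<subseteq> I"
  shows "Measurable.pred (PiM I M) (accepted stop acc n)"
proof -
  have r: "(\<lambda>h. restrict h {0..<k}) \<in> PiM I M \<rightarrow>\<^sub>M PiM {0..<k} M" if "k \<le> n" for k
    using that assms(3) by (intro measurable_restrict_subset) auto
  have [measurable]: "Measurable.pred (PiM I M) (\<lambda>h. stop k (restrict h {0..<k}))"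
      "Measurable.pred (PiM I M) (\<lambda>h. acc k (restrict h {0..<k}))" if "k \<le> n" for k
    using measurable_compose[OF r assms(1)] measurable_compose[OF r assms(2)] that by auto
  have "Measurable.pred (PiM I M) (\<lambda>h. \<forall>k\<in>{..<n}. \<not> stop k (restrict h {0..<k}))"
    by (rule pred_intros_finite) auto
  then have "Measurable.pred (PiM I M) (\<lambda>h. (\<forall>k\<in>{..<n}. \<not> stop k (restrict h {0..<k})) \<and>
     stop n (restrict h {0..<n}) \<and> acc n (restrict h {0..<n}))"
    by measurable
  then show ?thesis
    by (simp add: accepted_def[abs_def])
qed

lemma accepted_restrict: "k < n \<Longrightarrow> accepted stop acc k (restrict r {0..<n}) = accepted stop acc k r"
proof -
  assume "k < n"
  then have "restrict (restrict r {0..<n}) {0..<j} = restrict r {0..<j}" if "j \<le> k" for j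
    using that by (auto simp: restrict_def fun_eq_iff)
  then show ?thesis
    by (auto simp: accepted_def)
qed

lemma running_restrict: "running stop n (restrict r {0..<n}) = running stop n r"
proof -
  have "restrict (restrict r {0..<n}) {0..<j} = restrict r {0..<j}" if "j \<le> n" for j
    using that by (auto simp: restrict_def fun_eq_iff)
  then show ?thesis
    by (auto simp: running_def)
qed

text \<open>If the process stops at \<open>k\<close>, acceptance can happen only at a time up to
  \<open>k\<close>, and every test made by then reads coordinates below \<open>k\<close>, where the
  two paths agree.\<close>

lemma determined_when_stopped_accepted:
  "determined_when_stopped M stop n (\<lambda>h. of_bool (\<exists>j<n. accepted stop acc j h))"
proof -
  have imp: "\<exists>j<n. accepted stop acc j h'"
    if k: "k < n" and eq: "restrict h {0..<k} = restrict h' {0..<k}" and s: "stop k (restrict h {0..<k})"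
      and j: "j < n" "accepted stop acc j h" for h h' k j
  proof -
    have "j \<le> k"
      using j(2) s by (auto simp: accepted_def not_less[symmetric])
    have "restrict h {0..<i} = restrict h' {0..<i}" if "i \<le> k" for i
    proof
      fix x
      show "restrict h {0..<i} x = restrict h' {0..<i} x"
        using fun_cong[OF eq, of x] that by (auto simp: restrict_def)
    qed
    then have "accepted stop acc j h'"
      using j(2) \<open>j \<le> k\<close> by (auto simp: accepted_def)
    with j(1) show ?thesis by auto
  qed
  show ?thesis
    unfolding determined_when_stopped_def
  proof (intro ballI allI impI)
    fix h h' k
    assume a: "k < n" "restrict h {0..<k} = restrict h' {0..<k}" "stop k (restrict h {0..<k})"
    have "(\<exists>j<n. accepted stop acc j h) \<longleftrightarrow> (\<exists>j<n. accepted stop acc j h')"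
      using imp[of k h h'] imp[of k h' h] a by auto
    then show "of_bool (\<exists>j<n. accepted stop acc j h) = of_bool (\<exists>j<n. accepted stop acc j h')"
      by simp
  qed
qed

text \<open>Acceptance before a horizon \<open>n\<close> is an event of a finite prefix, to which
  the finite comparison applies. Its bound is dominated by a quantity independent of
  \<open>n\<close>, because the costs are nonnegative. Paths that never stop contribute to the cost
  but never to acceptance.\<close>

lemma emeasure_lim_accepted_le_add_cost:
  fixes M :: "nat \<Rightarrow> 'a measure"
  assumes "Ionescu_Tulcea P M" and "Ionescu_Tulcea Q M"
    and stop[measurable]: "\<And>n. Measurable.pred (PiM {0..<n} M) (stop n)"
    and acc[measurable]: "\<And>n. Measurable.pred (PiM {0..<n} M) (acc n)"
    and cost[measurable]: "\<And>n. cost n \<in> borel_measurable (PiM {0..<n} M)"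
    and step: "\<And>n h g. h \<in> space (PiM {0..<n} M) \<Longrightarrow> g \<in> borel_measurable (M n) \<Longrightarrow>
      (\<And>y. y \<in> space (M n) \<Longrightarrow> g y \<le> 1) \<Longrightarrow>
      (\<integral>\<^sup>+y. g y \<partial>P n h) \<le> (\<integral>\<^sup>+y. g y \<partial>Q n h) + cost n h"
  shows "emeasure (projective_family.lim UNIV (Ionescu_Tulcea.CI P M) M)
      {r \<in> space (PiM UNIV M). \<exists>n. accepted stop acc n r} \<le>
    emeasure (projective_family.lim UNIV (Ionescu_Tulcea.CI Q M) M)
      {r \<in> space (PiM UNIV M). \<exists>n. accepted stop acc n r} +
    (\<integral>\<^sup>+r. (\<Sum>n. cost n (restrict r {0..<n}) * of_bool (running stop n r))
      \<partial>projective_family.lim UNIV (Ionescu_Tulcea.CI Q M) M)"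
proof -
  interpret P: Ionescu_Tulcea P M by fact
  interpret Q: Ionescu_Tulcea Q M by fact
  let ?S = "space (PiM UNIV M)"
  have rest: "(\<lambda>r. restrict r {0..<n}) \<in> PiM UNIV M \<rightarrow>\<^sub>M PiM {0..<n} M" for n
    by (intro measurable_restrict_subset) auto
  have [measurable]: "Measurable.pred (PiM UNIV M) (running stop n)"
    "Measurable.pred (PiM {0..<n} M) (running stop n)" for n
    by (intro pred_running stop; auto)+
  have [measurable]: "Measurable.pred (PiM UNIV M) (accepted stop acc n)" for n
    by (intro pred_accepted stop acc) auto
  have acc_n: "Measurable.pred (PiM {0..<n} M) (\<lambda>h. \<exists>j\<in>{..<n}. accepted stop acc j h)" for n
    by (intro pred_intros_finite pred_accepted stop acc) auto
  define f :: "nat \<Rightarrow> (nat \<Rightarrow> 'a) \<Rightarrow> ennreal"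
    where "f n h = of_bool (\<exists>j<n. accepted stop acc j h)" for n h
  have f[measurable]: "f n \<in> borel_measurable (PiM {0..<n} M)" for n
    unfolding f_def[abs_def] using acc_n[of n] by (simp add: Bex_def)
  define B where "B n = {r \<in> ?S. \<exists>j<n. accepted stop acc j r}" for n
  have B[measurable]: "B n \<in> sets (PiM UNIV M)" for n
    unfolding B_def by measurable
  have f_restrict: "f n (restrict r {0..<n}) = indicator (B n) r" if "r \<in> ?S" for n r
    using that accepted_restrict[of _ n stop acc r] by (auto simp: f_def B_def indicator_def)
  have emeasure_B: "emeasure R (B n) = (\<integral>\<^sup>+r. f n (restrict r {0..<n}) \<partial>R)"
    if "sets R = sets (PiM UNIV M)" for n R
  proof -
    have "emeasure R (B n) = (\<integral>\<^sup>+r. indicator (B n) r \<partial>R)"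
      using that by simp
    also have "\<dots> = (\<integral>\<^sup>+r. f n (restrict r {0..<n}) \<partial>R)"
      by (rule nn_integral_cong) (simp add: f_restrict sets_eq_imp_space_eq[OF that])
    finally show ?thesis .
  qed
  have cost_n: "(\<lambda>h. cost n h * of_bool (running stop n h)) \<in> borel_measurable (PiM {0..<n} M)" for n
    by measurable
  have cost_lim: "(\<lambda>r. cost n (restrict r {0..<n}) * of_bool (running stop n r)) \<in> borel_measurable Q.PF.lim"
    for n
  proof -
    note measurable_compose[OF rest cost, measurable]
    show ?thesis
      by (simp add: measurable_cong_sets[OF Q.PF.sets_lim refl]) measurable
  qed
  have UN: "{r \<in> ?S. \<exists>n. accepted stop acc n r} = (\<Union>n. B n)"
    by (auto simp: B_def)
  have "emeasure P.PF.lim (B n) \<le> emeasure Q.PF.lim (\<Union>n. B n) +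
      (\<integral>\<^sup>+r. (\<Sum>n. cost n (restrict r {0..<n}) * of_bool (running stop n r)) \<partial>Q.PF.lim)" for n
  proof -
    have "emeasure P.PF.lim (B n) = (\<integral>\<^sup>+h. f n h \<partial>P.C 0 n (\<lambda>_. undefined))"
      by (simp add: emeasure_B P.nn_integral_lim_restrict)
    also have "\<dots> \<le> (\<integral>\<^sup>+h. f n h \<partial>Q.C 0 n (\<lambda>_. undefined)) +
        (\<Sum>k<n. \<integral>\<^sup>+h. cost k h * of_bool (running stop k h) \<partial>Q.C 0 k (\<lambda>_. undefined))"
      using assms(1,2) step unfolding f_def[abs_def]
      by (intro nn_integral_C_le_add_cost determined_when_stopped_accepted f[unfolded f_def[abs_def]]) auto
    also have "(\<integral>\<^sup>+h. f n h \<partial>Q.C 0 n (\<lambda>_. undefined)) = emeasure Q.PF.lim (B n)"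
      by (simp add: emeasure_B Q.nn_integral_lim_restrict)
    also have "\<dots> \<le> emeasure Q.PF.lim (\<Union>n. B n)"
      by (rule emeasure_mono) auto
    also have "(\<Sum>k<n. \<integral>\<^sup>+h. cost k h * of_bool (running stop k h) \<partial>Q.C 0 k (\<lambda>_. undefined)) =
        (\<Sum>k<n. \<integral>\<^sup>+r. cost k (restrict r {0..<k}) * of_bool (running stop k r) \<partial>Q.PF.lim)"
      using Q.nn_integral_lim_restrict[OF cost_n] by (simp add: running_restrict)
    also have "\<dots> = (\<integral>\<^sup>+r. (\<Sum>k<n. cost k (restrict r {0..<k}) * of_bool (running stop k r)) \<partial>Q.PF.lim)"
      by (rule nn_integral_sum[symmetric]) (rule cost_lim)
    also have "\<dots> \<le> (\<integral>\<^sup>+r. (\<Sum>n. cost n (restrict r {0..<n}) * of_bool (running stop n r)) \<partial>Q.PF.lim)"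
      by (intro nn_integral_mono sum_le_suminf) auto
    finally show ?thesis
      by (simp add: add_mono)
  qed
  \<comment> \<open>Continuity from below along the increasing events of acceptance before time
    \<open>n\<close>.\<close>
  moreover have "emeasure P.PF.lim (\<Union>n. B n) = (SUP n. emeasure P.PF.lim (B n))"
    by (rule SUP_emeasure_incseq[symmetric]) (auto simp: B_def incseq_def dest: less_le_trans)
  ultimately show ?thesis
    unfolding UN by (auto intro: SUP_least)
qed

section \<open>Comparing the runs of a procedure on two instances\<close>

text \<open>
  No measurability of \<open>f\<close> is needed, since \<open>distr\<close> degenerates to the null measure whenever its
  defining set function is not a measure.
\<close>

lemma emeasure_bind_le_1:
  fixes M :: "'a measure" and f :: "'a \<Rightarrow> 'b measure"
  assumes "subprob_space M"
  shows "emeasure (M \<bind> f) A \<le> 1"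
proof -
  interpret subprob_space M by fact
  define N where "N = f (SOME x. x \<in> space M)"
  have le_1: "emeasure (distr M (subprob_algebra N) f) B \<le> 1" for B
    by (simp add: distr_def emeasure_measure_of_conv subprob_emeasure_le_1)
  show ?thesis
  proof (cases "A \<in> sets (M \<bind> f)")
    case True
    have bind: "M \<bind> f = join (distr M (subprob_algebra N) f)"
      by (simp add: bind_nonempty subprob_not_empty N_def)
    have "emeasure (M \<bind> f) A = (\<integral>\<^sup>+M'. emeasure M' A \<partial>distr M (subprob_algebra N) f)"
      using True unfolding bind by (intro emeasure_join) auto
    also have "\<dots> \<le> (\<integral>\<^sup>+M'. 1 \<partial>distr M (subprob_algebra N) f)"
      by (intro nn_integral_mono) (auto simp: space_subprob_algebra intro: subprob_space.subprob_emeasure_le_1)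
    also have "\<dots> \<le> 1"
      using le_1 by simp
    finally show ?thesis .
  qed (simp add: emeasure_notin_sets)
qed

lemma measurable_reward_law:
  assumes "valid_instance TS OS m I"
  shows "reward_law I a \<in> TS \<rightarrow>\<^sub>M prob_algebra borel"
  using assms unfolding valid_instance_def reward_law_def[abs_def]
  by (intro measurable_distr_prob_space2[where M=OS]) auto

lemma sets_data_law:
  assumes "valid_instance TS OS m I"
  shows "sets (data_law TS OS m I) = sets (data_space TS OS m)"
proof -
  interpret prob_space "task_law I"
    using assms by (simp add: valid_instance_def)
  show ?thesis
    unfolding data_law_def by (rule sets_bind) (auto simp: not_empty split: prod.splits)
qed

lemma UNIV_agent: "(UNIV :: agent set) = {Current, Candidate}"
  by (auto intro: agent.exhaust)

lemma finite_agent: "finite (UNIV :: agent set)"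
  by (simp add: UNIV_agent)

section \<open>Disintegration of a run over data and seed\<close>

locale procedure_run =
  fixes TS :: "'t measure" and OS :: "'o measure" and m :: nat
    and I :: "('t, 'o) eval_instance" and \<pi> :: "('t, 'o) procedure"
  assumes I: "valid_instance TS OS m I" and \<pi>: "valid_procedure TS OS m \<pi>"
begin

definition X where "X = data_space TS OS m \<Otimes>\<^sub>M seed_law \<pi>"

definition K where "K n z = reward_law I (run_agent \<pi> n z) (run_task \<pi> n z)"

lemma prob_space_seed: "prob_space (seed_law \<pi>)"
  using \<pi> by (simp add: valid_procedure_def)

lemma measurable_procedure[measurable]:
  "Measurable.pred (X \<Otimes>\<^sub>M PiM {0..<n} (\<lambda>_. borel)) (stops \<pi> n)"
  "Measurable.pred (X \<Otimes>\<^sub>M PiM {0..<n} (\<lambda>_. borel)) (accepts \<pi> n)"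
  "run_agent \<pi> n \<in> X \<Otimes>\<^sub>M PiM {0..<n} (\<lambda>_. borel) \<rightarrow>\<^sub>M count_space UNIV"
  "run_task \<pi> n \<in> X \<Otimes>\<^sub>M PiM {0..<n} (\<lambda>_. borel) \<rightarrow>\<^sub>M TS"
  using \<pi> by (simp_all add: valid_procedure_def history_space_def X_def)

text \<open>Only finitely many agents exist, so measurability is checked for each fixed agent, as a
  composition with \<open>run_task\<close>, and glued along the values of
  \<open>run_agent\<close>.\<close>

lemma kernels: "parametric_kernels X K (\<lambda>_. borel)"
proof
  fix n
  show "K n \<in> X \<Otimes>\<^sub>M PiM {0..<n} (\<lambda>_. borel) \<rightarrow>\<^sub>M prob_algebra borel"
    unfolding K_def[abs_def]
  proof (rule measurable_compose_countable'[where g="run_agent \<pi> n" and I=UNIV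
        and f="\<lambda>a z. reward_law I a (run_task \<pi> n z)"])
    show "(\<lambda>z. reward_law I a (run_task \<pi> n z))
        \<in> X \<Otimes>\<^sub>M PiM {0..<n} (\<lambda>_. borel) \<rightarrow>\<^sub>M prob_algebra borel" for a
      by (rule measurable_compose[OF measurable_procedure(4) measurable_reward_law[OF I]])
  qed (simp_all add: UNIV_agent[symmetric] countable_finite finite_agent)
qed

sublocale parametric_kernels X K "\<lambda>_. borel"
  by (rule kernels)

lemma rollout_law_eq:
  "rollout_law I \<pi> x = projective_family.lim UNIV (Ionescu_Tulcea.CI (\<lambda>n h. K n (x, h)) (\<lambda>_. borel)) (\<lambda>_. borel)"
  by (simp add: rollout_law_def K_def)

lemma measurable_rollout_law[measurable]: "rollout_law I \<pi> \<in> X \<rightarrow>\<^sub>M prob_algebra (PiM UNIV (\<lambda>_. borel))"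
  unfolding rollout_law_eq[abs_def] by (rule measurable_lim)

lemma sets_rollout_law: "x \<in> space X \<Longrightarrow> sets (rollout_law I \<pi> x) = sets (PiM UNIV (\<lambda>_. borel))"
  using measurable_space[OF measurable_rollout_law] by (auto simp: space_prob_algebra)

definition runs where "runs x = distr (rollout_law I \<pi> x) (X \<Otimes>\<^sub>M PiM UNIV (\<lambda>_. borel)) (Pair x)"

lemma measurable_runs: "runs \<in> X \<rightarrow>\<^sub>M subprob_algebra (X \<Otimes>\<^sub>M PiM UNIV (\<lambda>_. borel))"
  unfolding runs_def[abs_def]
  by (intro measurable_prob_algebraD measurable_distr_prob_space2[OF measurable_rollout_law]) measurable

definition D where "D = data_law TS OS m I \<Otimes>\<^sub>M seed_law \<pi>"

lemma sets_D: "sets D = sets X"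
  unfolding D_def X_def by (intro sets_pair_measure_cong sets_data_law[OF I] refl)

lemma space_D: "space D = space X"
  by (rule sets_eq_imp_space_eq[OF sets_D])

text \<open>Bounded mass keeps all run laws finite, so that probabilities stated with
  \<open>measure\<close> can be carried over to \<open>emeasure\<close>.\<close>

lemma emeasure_data_law_le_1: "emeasure (data_law TS OS m I) A \<le> 1"
  unfolding data_law_def
  using I by (intro emeasure_bind_le_1 prob_space_imp_subprob_space) (simp add: valid_instance_def)

lemma emeasure_D_le_1: "emeasure D (space D) \<le> 1"
proof -
  interpret prob_space "seed_law \<pi>" by (rule prob_space_seed)
  show ?thesis
    unfolding D_def space_pair_measure
    by (subst emeasure_pair_measure_Times) (auto simp: emeasure_space_1 emeasure_data_law_le_1)
qed

lemma run_law_eq: "run_law TS OS m I \<pi> = D \<bind> runs"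
  by (simp add: run_law_def D_def runs_def[abs_def] X_def)

lemma measurable_runs_D: "runs \<in> D \<rightarrow>\<^sub>M subprob_algebra (X \<Otimes>\<^sub>M PiM UNIV (\<lambda>_. borel))"
  using measurable_runs by (simp add: measurable_cong_sets[OF sets_D refl])

lemma nn_integral_run_law:
  assumes f[measurable]: "f \<in> borel_measurable (X \<Otimes>\<^sub>M PiM UNIV (\<lambda>_. borel))"
  shows "(\<integral>\<^sup>+\<omega>. f \<omega> \<partial>run_law TS OS m I \<pi>) = (\<integral>\<^sup>+x. \<integral>\<^sup>+r. f (x, r) \<partial>rollout_law I \<pi> x \<partial>D)"
proof -
  have "(\<integral>\<^sup>+\<omega>. f \<omega> \<partial>run_law TS OS m I \<pi>) = (\<integral>\<^sup>+x. \<integral>\<^sup>+\<omega>. f \<omega> \<partial>runs x \<partial>D)"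
    unfolding run_law_eq by (rule nn_integral_bind[OF f measurable_runs_D])
  also have "\<dots> = (\<integral>\<^sup>+x. \<integral>\<^sup>+r. f (x, r) \<partial>rollout_law I \<pi> x \<partial>D)"
  proof (rule nn_integral_cong)
    fix x assume "x \<in> space D"
    then have x: "x \<in> space X" by (simp add: space_D)
    show "(\<integral>\<^sup>+\<omega>. f \<omega> \<partial>runs x) = (\<integral>\<^sup>+r. f (x, r) \<partial>rollout_law I \<pi> x)"
      unfolding runs_def
      using x by (intro nn_integral_distr) (simp_all add: measurable_cong_sets[OF sets_rollout_law[OF x] refl])
  qed
  finally show ?thesis .
qed

lemma sets_run_law:
  assumes "space X \<noteq> {}"
  shows "sets (run_law TS OS m I \<pi>) = sets (X \<Otimes>\<^sub>M PiM UNIV (\<lambda>_. borel))"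
  unfolding run_law_eq using assms by (intro sets_bind) (auto simp: runs_def space_D)

lemma emeasure_run_law_le_1: "emeasure (run_law TS OS m I \<pi>) A \<le> 1"
proof (cases "space D = {}")
  \<comment> \<open>A \<open>bind\<close> over an empty space is the measure on the empty space,
    where only the empty set is measurable.\<close>
  case True
  then show ?thesis
    by (cases "A = {}") (simp_all add: run_law_eq bind_empty emeasure_notin_sets)
next
  case False
  then have "subprob_space D"
    by (intro subprob_spaceI emeasure_D_le_1)
  then show ?thesis
    unfolding run_law_eq by (rule emeasure_bind_le_1)
qed

lemma validates_iff:
  "validates \<pi> (x, r) \<longleftrightarrow> (\<exists>n. accepted (\<lambda>k h. stops \<pi> k (x, h)) (\<lambda>k h. accepts \<pi> k (x, h)) n r)"
  by (simp add: validates_def accepted_def history_at_def)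

text \<open>Exhibits the number of runs as an accumulated cost series: the cost of a rollout is the
  indicator that the candidate is run.\<close>

lemma N_eval_eq:
  "N_eval \<pi> (x, r) = (\<Sum>n. of_bool (run_agent \<pi> n (x, restrict r {0..<n}) = Candidate) *
     of_bool (running (\<lambda>k h. stops \<pi> k (x, h)) n r))"
  by (auto simp: N_eval_def running_def history_at_def intro!: suminf_cong)

lemma measurable_history_at:
  "history_at n \<in> X \<Otimes>\<^sub>M PiM UNIV (\<lambda>_. borel) \<rightarrow>\<^sub>M X \<Otimes>\<^sub>M PiM {0..<n} (\<lambda>_. borel)"
  unfolding history_at_def[abs_def]
  by (intro measurable_Pair measurable_fst measurable_compose[OF measurable_snd measurable_restrict_subset]) auto

lemma measurable_at_history[measurable]:
  "Measurable.pred (X \<Otimes>\<^sub>M PiM UNIV (\<lambda>_. borel)) (\<lambda>\<omega>. stops \<pi> n (history_at n \<omega>))"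
  "Measurable.pred (X \<Otimes>\<^sub>M PiM UNIV (\<lambda>_. borel)) (\<lambda>\<omega>. accepts \<pi> n (history_at n \<omega>))"
  "(\<lambda>\<omega>. run_agent \<pi> n (history_at n \<omega>)) \<in> X \<Otimes>\<^sub>M PiM UNIV (\<lambda>_. borel) \<rightarrow>\<^sub>M count_space UNIV"
  by (rule measurable_compose[OF measurable_history_at measurable_procedure(1)]
      measurable_compose[OF measurable_history_at measurable_procedure(2)]
      measurable_compose[OF measurable_history_at measurable_procedure(3)])+

lemma pred_validates[measurable]: "Measurable.pred (X \<Otimes>\<^sub>M PiM UNIV (\<lambda>_. borel)) (validates \<pi>)"
  unfolding validates_def[abs_def] by measurable

lemma borel_measurable_N_eval[measurable]: "N_eval \<pi> \<in> borel_measurable (X \<Otimes>\<^sub>M PiM UNIV (\<lambda>_. borel))"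
  unfolding N_eval_def[abs_def] by measurable

end

text \<open>Data and seed have the same law in both instances, so the comparison can be made for
  each fixed \<open>x\<close> and then integrated. Current-agent rollouts cost nothing; a candidate
  rollout costs \<open>c\<close>.\<close>

lemma emeasure_validates_le_add_runs:
  assumes I: "valid_instance TS OS m I" and I': "valid_instance TS OS m I'" and \<pi>: "valid_procedure TS OS m \<pi>"
    and data: "data_law TS OS m I = data_law TS OS m I'"
    and reward: "\<And>a t g. t \<in> space TS \<Longrightarrow> g \<in> borel_measurable borel \<Longrightarrow> (\<And>y. g y \<le> 1) \<Longrightarrow>
      (\<integral>\<^sup>+y. g y \<partial>reward_law I a t) \<le> (\<integral>\<^sup>+y. g y \<partial>reward_law I' a t) + c * of_bool (a = Candidate)"
  shows "emeasure (run_law TS OS m I \<pi>) {\<omega> \<in> space (run_law TS OS m I \<pi>). validates \<pi> \<omega>} \<le>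
    emeasure (run_law TS OS m I' \<pi>) {\<omega> \<in> space (run_law TS OS m I' \<pi>). validates \<pi> \<omega>} +
    c * (\<integral>\<^sup>+\<omega>. N_eval \<pi> \<omega> \<partial>run_law TS OS m I' \<pi>)"
proof -
  interpret R: procedure_run TS OS m I \<pi> by standard fact+
  interpret R': procedure_run TS OS m I' \<pi> by standard fact+
  have D': "R'.D = R.D" by (simp add: R.D_def R'.D_def data)
  let ?\<Pi> = "PiM UNIV (\<lambda>_. borel) :: (nat \<Rightarrow> real) measure"
  let ?V = "\<lambda>x. {r \<in> space ?\<Pi>. \<exists>n. accepted (\<lambda>k h. stops \<pi> k (x, h)) (\<lambda>k h. accepts \<pi> k (x, h)) n r}"
  show ?thesis
  \<comment> \<open>The sigma-algebra of a run law is identified only over a nonempty space; over an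
    empty one the left-hand side is 0.\<close>
  proof (cases "space R.X = {}")
    case True
    then have "space R.D = {}" by (simp add: R.space_D)
    then show ?thesis
      by (simp add: R.run_law_eq bind_empty)
  next
    case False
    have V: "?V x \<in> sets ?\<Pi>" if "x \<in> space R.X" for x
    proof -
      have "{r \<in> space ?\<Pi>. validates \<pi> (x, r)} \<in> sets ?\<Pi>"
        using that by measurable
      then show ?thesis by (simp add: R.validates_iff)
    qed
    have emeasure_V: "emeasure (run_law TS OS m J \<pi>) {\<omega> \<in> space (run_law TS OS m J \<pi>). validates \<pi> \<omega>} =
        (\<integral>\<^sup>+x. emeasure (rollout_law J \<pi> x) (?V x) \<partial>R.D)"
      if J: "valid_instance TS OS m J" "data_law TS OS m J = data_law TS OS m I" for J
    proof -
      interpret J: procedure_run TS OS m J \<pi> by standard fact+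
      have D: "J.D = R.D" by (simp add: J.D_def R.D_def J)
      have sets: "sets (run_law TS OS m J \<pi>) = sets (R.X \<Otimes>\<^sub>M ?\<Pi>)"
        using J.sets_run_law False by simp
      have "emeasure (run_law TS OS m J \<pi>) {\<omega> \<in> space (run_law TS OS m J \<pi>). validates \<pi> \<omega>} =
          (\<integral>\<^sup>+\<omega>. indicator {\<omega> \<in> space (R.X \<Otimes>\<^sub>M ?\<Pi>). validates \<pi> \<omega>} \<omega> \<partial>run_law TS OS m J \<pi>)"
        by (subst nn_integral_indicator) (simp_all add: sets sets_eq_imp_space_eq[OF sets])
      also have "\<dots> = (\<integral>\<^sup>+x. \<integral>\<^sup>+r. indicator {\<omega> \<in> space (R.X \<Otimes>\<^sub>M ?\<Pi>). validates \<pi> \<omega>} (x, r)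
          \<partial>rollout_law J \<pi> x \<partial>R.D)"
        unfolding D[symmetric] by (rule J.nn_integral_run_law) measurable
      also have "\<dots> = (\<integral>\<^sup>+x. emeasure (rollout_law J \<pi> x) (?V x) \<partial>R.D)"
      proof (rule nn_integral_cong)
        fix x assume "x \<in> space R.D"
        then have x: "x \<in> space R.X" by (simp add: R.space_D)
        have s: "sets (rollout_law J \<pi> x) = sets ?\<Pi>"
          using J.sets_rollout_law x by simp
        have "(\<integral>\<^sup>+r. indicator {\<omega> \<in> space (R.X \<Otimes>\<^sub>M ?\<Pi>). validates \<pi> \<omega>} (x, r) \<partial>rollout_law J \<pi> x) =
            (\<integral>\<^sup>+r. indicator (?V x) r \<partial>rollout_law J \<pi> x)"
          using x by (intro nn_integral_cong)
            (auto simp: indicator_def R.validates_iff space_pair_measure sets_eq_imp_space_eq[OF s])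
        also have "\<dots> = emeasure (rollout_law J \<pi> x) (?V x)"
          using V[OF x] by (simp add: s)
        finally show "(\<integral>\<^sup>+r. indicator {\<omega> \<in> space (R.X \<Otimes>\<^sub>M ?\<Pi>). validates \<pi> \<omega>} (x, r) \<partial>rollout_law J \<pi> x) =
            emeasure (rollout_law J \<pi> x) (?V x)" .
      qed
      finally show ?thesis .
    qed
    have le: "emeasure (rollout_law I \<pi> x) (?V x) \<le> emeasure (rollout_law I' \<pi> x) (?V x) +
        (\<integral>\<^sup>+r. c * N_eval \<pi> (x, r) \<partial>rollout_law I' \<pi> x)" if x: "x \<in> space R.X" for x
    proof -
      have [measurable]: "Pair x \<in> PiM {0..<n} (\<lambda>_. borel) \<rightarrow>\<^sub>M R.X \<Otimes>\<^sub>M PiM {0..<n} (\<lambda>_. borel)" for n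
        using x by measurable
      define cost where "cost n h = c * of_bool (run_agent \<pi> n (x, h) = Candidate)" for n h
      have "emeasure (rollout_law I \<pi> x) (?V x) \<le> emeasure (rollout_law I' \<pi> x) (?V x) +
        (\<integral>\<^sup>+r. (\<Sum>n. cost n (restrict r {0..<n}) * of_bool (running (\<lambda>k h. stops \<pi> k (x, h)) n r))
           \<partial>rollout_law I' \<pi> x)"
        unfolding R.rollout_law_eq R'.rollout_law_eq
      proof (rule emeasure_lim_accepted_le_add_cost)
        show "Ionescu_Tulcea (\<lambda>n h. R.K n (x, h)) (\<lambda>_. borel)"
          by (rule R.Ionescu_Tulcea[OF x])
        show "Ionescu_Tulcea (\<lambda>n h. R'.K n (x, h)) (\<lambda>_. borel)"
          by (rule R'.Ionescu_Tulcea[OF x])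
        show "cost n \<in> borel_measurable (PiM {0..<n} (\<lambda>_. borel))" for n
          unfolding cost_def[abs_def] by measurable
        fix n and h :: "nat \<Rightarrow> real" and g :: "real \<Rightarrow> ennreal"
        assume h: "h \<in> space (PiM {0..<n} (\<lambda>_. borel))" and g: "g \<in> borel_measurable borel"
          "\<And>y. y \<in> space borel \<Longrightarrow> g y \<le> 1"
        have "(x, h) \<in> space (R.X \<Otimes>\<^sub>M PiM {0..<n} (\<lambda>_. borel))"
          using x h by (simp add: space_pair_measure)
        then have "run_task \<pi> n (x, h) \<in> space TS"
          by (rule measurable_space[OF R.measurable_procedure(4)])
        then show "(\<integral>\<^sup>+y. g y \<partial>R.K n (x, h)) \<le> (\<integral>\<^sup>+y. g y \<partial>R'.K n (x, h)) + cost n h"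
          using reward[OF _ g(1)] g(2) by (simp add: R.K_def R'.K_def cost_def)
      qed measurable
      also have "(\<lambda>r. \<Sum>n. cost n (restrict r {0..<n}) * of_bool (running (\<lambda>k h. stops \<pi> k (x, h)) n r)) =
          (\<lambda>r. c * N_eval \<pi> (x, r))"
        by (simp add: cost_def R.N_eval_eq mult.assoc ennreal_suminf_cmult)
      finally show ?thesis .
    qed
    have "emeasure (run_law TS OS m I \<pi>) {\<omega> \<in> space (run_law TS OS m I \<pi>). validates \<pi> \<omega>} =
        (\<integral>\<^sup>+x. emeasure (rollout_law I \<pi> x) (?V x) \<partial>R.D)"
      using emeasure_V[OF I] by simp
    also have "\<dots> \<le> (\<integral>\<^sup>+x. emeasure (rollout_law I' \<pi> x) (?V x) +
        (\<integral>\<^sup>+r. c * N_eval \<pi> (x, r) \<partial>rollout_law I' \<pi> x) \<partial>R.D)"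
      by (intro nn_integral_mono le) (simp add: R.space_D)
    also have "\<dots> = (\<integral>\<^sup>+x. emeasure (rollout_law I' \<pi> x) (?V x) \<partial>R.D) +
        (\<integral>\<^sup>+x. \<integral>\<^sup>+r. c * N_eval \<pi> (x, r) \<partial>rollout_law I' \<pi> x \<partial>R.D)"
    proof (rule nn_integral_add)
      note rollout = measurable_prob_algebraD[OF R'.measurable_rollout_law]
      have "(\<lambda>x. \<integral>\<^sup>+r. c * N_eval \<pi> (x, r) \<partial>rollout_law I' \<pi> x) \<in> borel_measurable R.X"
        by (rule nn_integral_measurable_subprob_algebra2[OF _ rollout]) measurable
      then show "(\<lambda>x. \<integral>\<^sup>+r. c * N_eval \<pi> (x, r) \<partial>rollout_law I' \<pi> x) \<in> borel_measurable R.D"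
        by (simp add: measurable_cong_sets[OF R.sets_D refl])
      \<comment> \<open>The sets \<open>?V x\<close> are the sections of one measurable event, hence
        their measures under the rollout kernel depend measurably on \<open>x\<close>.\<close>
      have "(SIGMA x:space R.X. ?V x) = {\<omega> \<in> space (R.X \<Otimes>\<^sub>M ?\<Pi>). validates \<pi> \<omega>}"
        by (auto simp: space_pair_measure R.validates_iff)
      then have "(\<lambda>x. emeasure (rollout_law I' \<pi> x) (?V x)) \<in> borel_measurable R.X"
        by (intro emeasure_measurable_subprob_algebra2[OF _ rollout]) simp
      then show "(\<lambda>x. emeasure (rollout_law I' \<pi> x) (?V x)) \<in> borel_measurable R.D"
        by (simp add: measurable_cong_sets[OF R.sets_D refl])
    qed
    finally have *: "emeasure (run_law TS OS m I \<pi>) {\<omega> \<in> space (run_law TS OS m I \<pi>). validates \<pi> \<omega>} \<le>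
        (\<integral>\<^sup>+x. emeasure (rollout_law I' \<pi> x) (?V x) \<partial>R.D) +
        (\<integral>\<^sup>+x. \<integral>\<^sup>+r. c * N_eval \<pi> (x, r) \<partial>rollout_law I' \<pi> x \<partial>R.D)" .
    have "(\<lambda>\<omega>. c * N_eval \<pi> \<omega>) \<in> borel_measurable (R.X \<Otimes>\<^sub>M ?\<Pi>)"
      by measurable
    from R'.nn_integral_run_law[OF this, symmetric]
    have "(\<integral>\<^sup>+x. \<integral>\<^sup>+r. c * N_eval \<pi> (x, r) \<partial>rollout_law I' \<pi> x \<partial>R.D) =
        (\<integral>\<^sup>+\<omega>. c * N_eval \<pi> \<omega> \<partial>run_law TS OS m I' \<pi>)"
      unfolding D' .
    moreover have "(\<integral>\<^sup>+\<omega>. c * N_eval \<pi> \<omega> \<partial>run_law TS OS m I' \<pi>) =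
        c * (\<integral>\<^sup>+\<omega>. N_eval \<pi> \<omega> \<partial>run_law TS OS m I' \<pi>)"
    proof (rule nn_integral_cmult)
      show "N_eval \<pi> \<in> borel_measurable (run_law TS OS m I' \<pi>)"
        by (simp add: measurable_cong_sets[OF R'.sets_run_law[OF False] refl])
    qed
    ultimately show ?thesis
      using * emeasure_V[OF I' data[symmetric]] by simp
  qed
qed

section \<open>Independent, identically distributed streams\<close>

lemma measurable_shift: "shift k \<in> stream_space_of M \<rightarrow>\<^sub>M stream_space_of M"
  unfolding shift_def[abs_def] by (rule measurable_PiM_single') (auto simp: space_PiM)

lemma shift_in_space: "s \<in> space (stream_space_of M) \<Longrightarrow> shift k s \<in> space (stream_space_of M)"
  by (rule measurable_space[OF measurable_shift])

context sequence_space
begin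

text \<open>An i.i.d. sequence can be spliced from two independent copies, the first supplying the
  coordinates below \<open>j\<close>. Since \<open>k < j\<close>, the past reads only the first
  copy, while the shift by \<open>j\<close> returns exactly the second.\<close>

lemma past_future_independent:
  assumes "k < j"
  shows "distr S (PiM {..k} (\<lambda>_. M) \<Otimes>\<^sub>M S) (\<lambda>s. (restrict s {..k}, shift j s)) =
    distr S (PiM {..k} (\<lambda>_. M)) (\<lambda>s. restrict s {..k}) \<Otimes>\<^sub>M S" (is "?L = ?R")
proof -
  have past[measurable]: "(\<lambda>s. restrict s {..k}) \<in> S \<rightarrow>\<^sub>M PiM {..k} (\<lambda>_. M)"
    by (rule measurable_restrict_subset) auto
  note measurable_shift[measurable]
  have "?L = distr (distr (S \<Otimes>\<^sub>M S) S (\<lambda>(\<omega>, \<omega>'). comb_seq j \<omega> \<omega>')) (PiM {..k} (\<lambda>_. M) \<Otimes>\<^sub>M S)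
      (\<lambda>s. (restrict s {..k}, shift j s))"
    by (simp only: PiM_comb_seq)
  also have "\<dots> = distr (S \<Otimes>\<^sub>M S) (PiM {..k} (\<lambda>_. M) \<Otimes>\<^sub>M S)
      ((\<lambda>s. (restrict s {..k}, shift j s)) \<circ> (\<lambda>(\<omega>, \<omega>'). comb_seq j \<omega> \<omega>'))"
    by (rule distr_distr) measurable
  also have "(\<lambda>s. (restrict s {..k}, shift j s)) \<circ> (\<lambda>(\<omega>, \<omega>'). comb_seq j \<omega> \<omega>') =
      (\<lambda>(\<omega>, \<omega>'). (restrict \<omega> {..k}, \<omega>'))"
    using assms by (auto simp: fun_eq_iff restrict_def shift_def comb_seq_def)
  also have "distr (S \<Otimes>\<^sub>M S) (PiM {..k} (\<lambda>_. M) \<Otimes>\<^sub>M S) \<dots> =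
      distr S (PiM {..k} (\<lambda>_. M)) (\<lambda>s. restrict s {..k}) \<Otimes>\<^sub>M distr S S (\<lambda>s. s)"
    by (rule pair_measure_distr[symmetric])
       (auto simp: distr_id[unfolded id_def] intro: prob_space_imp_sigma_finite P.prob_space_axioms)
  also have "distr S S (\<lambda>s. s) = S"
    by (rule distr_id[unfolded id_def])
  finally show ?thesis .
qed

lemma distr_shift: "distr S S (shift j) = S"
proof -
  note measurable_shift[measurable]
  have "distr S S (shift j) = distr (distr (S \<Otimes>\<^sub>M S) S (\<lambda>(\<omega>, \<omega>'). comb_seq j \<omega> \<omega>')) S (shift j)"
    by (simp only: PiM_comb_seq)
  also have "\<dots> = distr (S \<Otimes>\<^sub>M S) S (shift j \<circ> (\<lambda>(\<omega>, \<omega>'). comb_seq j \<omega> \<omega>'))"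
    by (rule distr_distr) measurable
  also have "shift j \<circ> (\<lambda>(\<omega>, \<omega>'). comb_seq j \<omega> \<omega>') = snd"
    by (auto simp: fun_eq_iff shift_def comb_seq_def)
  also have "distr (S \<Otimes>\<^sub>M S) S snd = S"
  proof (rule measure_eqI)
    fix A assume "A \<in> sets (distr (S \<Otimes>\<^sub>M S) S snd)"
    then have A[measurable]: "A \<in> sets S" by simp
    have "snd -` A \<inter> space (S \<Otimes>\<^sub>M S) = space S \<times> A"
      using sets.sets_into_space[OF A] by (auto simp: space_pair_measure)
    then show "emeasure (distr (S \<Otimes>\<^sub>M S) S snd) A = emeasure S A"
      by (simp add: emeasure_distr P.emeasure_pair_measure_Times P.emeasure_space_1)
  qed simp
  finally show ?thesis .
qed

lemma stationary_iid: "stationary M S"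
  by (simp add: stationary_def distr_shift)

text \<open>For a positive gap the joint law is the product law and the coefficient is 0. At gap 0
  past and future share the time \<open>k\<close>, so the coefficients are claimed to vanish only
  from index 1 on.\<close>

lemma beta_mixing_iid: "beta_mixing M S"
proof -
  have "beta_coeff M S n = 0" if "0 < n" for n
  proof -
    \<comment> \<open>A real supremum of the constant 0 is known to be 0 only over a nonempty index
      set.\<close>
    have "sets N \<noteq> {}" for N :: "((nat \<Rightarrow> 'a) \<times> (nat \<Rightarrow> 'a)) measure"
      using sets.empty_sets by blast
    then show ?thesis
      using that by (simp add: beta_coeff_def Let_def past_future_independent distr_shift)
  qed
  then have "\<forall>\<^sub>F n in sequentially. beta_coeff M S n = 0"
    by (auto simp: eventually_sequentially intro: exI[of _ 1])
  then show ?thesis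
    unfolding beta_mixing_def by (rule tendsto_eventually)
qed

text \<open>
  A shift-invariant event is an event of the distant future, hence independent of every
  cylinder set, and therefore of itself.
\<close>

lemma ergodic_iid: "ergodic S"
  unfolding ergodic_def
proof (intro ballI impI)
  fix A assume A[measurable]: "A \<in> sets S" and invariant: "shift 1 -` A \<inter> space S = A"
  have shift_A: "shift k s \<in> A \<longleftrightarrow> s \<in> A" if "s \<in> space S" for k s
  proof (induction k)
    case 0
    then show ?case by (simp add: shift_def)
  next
    case (Suc k)
    have "shift (Suc k) s = shift 1 (shift k s)"
      by (simp add: shift_def)
    moreover have "shift 1 (shift k s) \<in> A \<longleftrightarrow> shift k s \<in> A"
      using shift_in_space[OF that, of k] invariant by blast
    ultimately show ?case using Suc by simp
  qed
  \<comment> \<open>Independence of \<open>A\<close> from every event, written as equality of two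
    finite measures so that cylinders suffice. Evaluation at \<open>A\<close> itself then shows that
    its probability is its own square.\<close>
  have "density S (indicator A) = density S (\<lambda>_. emeasure S A)"
  proof (rule measure_eqI_PiM_infinite[of _ UNIV "\<lambda>_. M"])
    fix J :: "nat set" and F assume J: "finite J" "J \<subseteq> UNIV" and F: "\<And>i. i \<in> J \<Longrightarrow> F i \<in> sets M"
    define k where "k = Max (insert 0 J)"
    have k: "J \<subseteq> {..k}" using J by (auto simp: k_def)
    let ?PS = "PiM {..k} (\<lambda>_. M)"
    let ?past = "\<lambda>s. restrict s {..k}"
    define B where "B = prod_emb {..k} (\<lambda>_. M) J (Pi\<^sub>E J F)"
    define E where "E = prod_emb UNIV (\<lambda>_. M) J (Pi\<^sub>E J F)"
    have [measurable]: "B \<in> sets ?PS" "E \<in> sets S"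
      unfolding B_def E_def using J k F by (auto intro!: measurable_prod_emb sets_PiM_I_finite)
    have past[measurable]: "?past \<in> S \<rightarrow>\<^sub>M ?PS"
      by (rule measurable_restrict_subset) auto
    note measurable_shift[measurable]
    have past_B: "?past s \<in> B \<longleftrightarrow> s \<in> E" if "s \<in> space S" for s
      using that k by (auto simp: B_def E_def prod_emb_def space_PiM PiE_iff extensional_def restrict_def subset_eq split: if_splits)
    have vimage: "?past -` B \<inter> space S = E"
      using past_B sets.sets_into_space[of E S] by auto
    \<comment> \<open>By invariance \<open>A\<close> can be read off from the sequence shifted by
      \<open>Suc k\<close>, which shares no coordinate with the past up to \<open>k\<close>.\<close>
    have joint: "(\<lambda>s. (?past s, shift (Suc k) s)) -` (B \<times> A) \<inter> space S = A \<inter> E"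
      using past_B shift_A sets.sets_into_space[OF A] by auto
    interpret past: prob_space "distr S ?PS ?past"
      by (rule P.prob_space_distr) simp
    have "emeasure S (A \<inter> E) = emeasure (distr S (?PS \<Otimes>\<^sub>M S) (\<lambda>s. (?past s, shift (Suc k) s))) (B \<times> A)"
      by (subst emeasure_distr) (simp_all add: joint)
    also have "\<dots> = emeasure (distr S ?PS ?past) B * emeasure S A"
      by (simp add: past_future_independent P.emeasure_pair_measure_Times)
    also have "emeasure (distr S ?PS ?past) B = emeasure S E"
      by (subst emeasure_distr) (simp_all add: vimage)
    finally have "emeasure S (A \<inter> E) = emeasure S A * emeasure S E"
      by (simp add: mult.commute)
    then show "emeasure (density S (indicator A)) (prod_emb UNIV (\<lambda>_. M) J (Pi\<^sub>E J F)) =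
        emeasure (density S (\<lambda>_. emeasure S A)) (prod_emb UNIV (\<lambda>_. M) J (Pi\<^sub>E J F))"
      unfolding E_def[symmetric]
      by (simp add: emeasure_density_const emeasure_density flip: indicator_inter_arith)
  next
    show "finite_measure (density S (indicator A))"
      by (rule finite_measureI) (simp add: emeasure_density)
  qed simp_all
  then have "emeasure (density S (indicator A)) A = emeasure (density S (\<lambda>_. emeasure S A)) A"
    by simp
  then have "emeasure S A = emeasure S A * emeasure S A"
    by (simp add: emeasure_density_const emeasure_density flip: indicator_inter_arith)
  then have "measure S A = measure S A * measure S A"
    by (simp add: P.emeasure_eq_measure flip: ennreal_mult)
  then show "measure S A = 0 \<or> measure S A = 1"
    by auto
qed

end

section \<open>The pair of instances\<close>

text \<open>Serves as the law of tasks, where 1 is the failure task, and as the law of outputs,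
  where 1 is the rewarded one.\<close>

definition coin :: "real \<Rightarrow> real pmf" where
  "coin p = map_pmf of_bool (bernoulli_pmf p)"

lemma integral_coin:
  fixes f :: "real \<Rightarrow> real"
  assumes "0 \<le> p" "p \<le> 1"
  shows "(\<integral>x. f x \<partial>coin p) = f 1 * p + f 0 * (1 - p)"
  using assms by (simp add: coin_def)

lemma nn_integral_coin:
  fixes f :: "real \<Rightarrow> ennreal"
  assumes "0 \<le> p" "p \<le> 1"
  shows "(\<integral>\<^sup>+x. f x \<partial>coin p) = f 1 * ennreal p + f 0 * ennreal (1 - p)"
  using assms by (simp add: coin_def)

text \<open>The coin with the larger parameter has surplus mass only at 1, namely
  \<open>p - q\<close>; its deficit at 0 can only lower the left-hand side.\<close>

lemma nn_integral_coin_le: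
  fixes g :: "real \<Rightarrow> ennreal"
  assumes "0 \<le> q" "q \<le> p" "p \<le> 1" and "g 1 \<le> 1"
  shows "(\<integral>\<^sup>+x. g x \<partial>coin p) \<le> (\<integral>\<^sup>+x. g x \<partial>coin q) + ennreal (p - q)"
proof -
  have "g 1 * ennreal p = g 1 * ennreal q + g 1 * ennreal (p - q)"
    using assms by (simp flip: distrib_left ennreal_plus)
  moreover have "g 1 * ennreal (p - q) \<le> ennreal (p - q)"
    using mult_right_mono[OF assms(4), of "ennreal (p - q)"] by simp
  moreover have "g 0 * ennreal (1 - p) \<le> g 0 * ennreal (1 - q)"
    using assms by (intro mult_left_mono ennreal_leI) auto
  ultimately show ?thesis
    using assms by (simp add: nn_integral_coin) (metis (no_types, lifting) add.assoc add.commute add_mono)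
qed

text \<open>
  The failure mark depends on the task only, so that it carries no information on the rewards:
  task \<open>1\<close> is a certain failure, yet it may be rewarded.
\<close>

definition two_task_instance :: "nat \<Rightarrow> real \<Rightarrow> real \<Rightarrow> real \<Rightarrow> (real, real) eval_instance" where
  "two_task_instance m Z p q =
     \<lparr>user_dist = measure_pmf (coin Z),
      reward = \<lambda>_ y. of_bool (y = 1),
      fails = \<lambda>t _. t = 1,
      kernel = \<lambda>a t. measure_pmf (coin (if t = 1 then case a of Current \<Rightarrow> p | Candidate \<Rightarrow> q else 1)),
      task_law = (\<Pi>\<^sub>M i\<in>UNIV. measure_pmf (coin Z)) \<Otimes>\<^sub>M (\<Pi>\<^sub>M i\<in>{..<m}. measure_pmf (coin Z))\<rparr>"

context
  fixes m :: nat and Z p q :: real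
  assumes Z: "0 < Z" "Z < 1" and p: "0 \<le> p" "p \<le> 1" and q: "0 \<le> q" "q \<le> 1"
begin

lemma user_dist_two_task: "user_dist (two_task_instance m Z p q) = measure_pmf (coin Z)"
  by (simp add: two_task_instance_def)

lemma task_value_two_task:
  "task_value (two_task_instance m Z p q) a t = (if t = 1 then case a of Current \<Rightarrow> p | Candidate \<Rightarrow> q else 1)"
  using p q by (auto simp: task_value_def two_task_instance_def integral_coin split: agent.split)

lemma J_user_two_task:
  "J_user (two_task_instance m Z p q) a = 1 - Z * (1 - (case a of Current \<Rightarrow> p | Candidate \<Rightarrow> q))"
  unfolding J_user_def task_value_two_task
  using Z by (simp add: two_task_instance_def integral_coin algebra_simps)

lemma fail_prob_two_task: "fail_prob (two_task_instance m Z p q) t = of_bool (t = 1)"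
  by (simp add: fail_prob_def two_task_instance_def measure_pmf.prob_space)

lemma fail_mass_two_task: "fail_mass (two_task_instance m Z p q) = Z"
  unfolding fail_mass_def fail_prob_two_task
  using Z by (simp add: two_task_instance_def integral_coin)

text \<open>On task 1 the retained density vanishes; on every other task both agents have value
  1.\<close>

lemma regression_two_task: "regression (two_task_instance m Z p q) = 0"
proof -
  have "regression (two_task_instance m Z p q) = (\<integral>t. (1 - fail_prob (two_task_instance m Z p q) t) / (1 - Z) *
      \<bar>task_value (two_task_instance m Z p q) Candidate t - task_value (two_task_instance m Z p q) Current t\<bar> \<partial>user_dist (two_task_instance m Z p q))"
    unfolding regression_def retained_dist_def fail_mass_two_task
    using Z by (subst integral_density) (auto simp: fail_prob_two_task user_dist_two_task)
  also have "\<dots> = (\<integral>t. 0 \<partial>user_dist (two_task_instance m Z p q))"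
    by (rule Bochner_Integration.integral_cong) (auto simp: fail_prob_two_task task_value_two_task)
  finally show ?thesis by simp
qed

lemma valid_two_task: "valid_instance (measure_pmf (coin Z)) (count_space UNIV) m (two_task_instance m Z p q)"
proof -
  interpret stream: sequence_space "measure_pmf (coin Z)"
    by unfold_locales
  interpret ref: prob_space "\<Pi>\<^sub>M i\<in>{..<m}. measure_pmf (coin Z)"
    by (rule prob_space_PiM) (rule prob_space_measure_pmf)
  interpret stream_prob: prob_space "\<Pi>\<^sub>M i\<in>(UNIV :: nat set). measure_pmf (coin Z)"
    by (rule prob_space_PiM) (rule prob_space_measure_pmf)
  interpret pair: pair_prob_space "\<Pi>\<^sub>M i\<in>(UNIV :: nat set). measure_pmf (coin Z)" "\<Pi>\<^sub>M i\<in>{..<m}. measure_pmf (coin Z)"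
    by unfold_locales
  have "distr (task_law (two_task_instance m Z p q)) (\<Pi>\<^sub>M i\<in>UNIV. measure_pmf (coin Z)) fst = (\<Pi>\<^sub>M i\<in>UNIV. measure_pmf (coin Z))"
    by (simp add: two_task_instance_def ref.distr_pair_fst)
  moreover have "distr (\<Pi>\<^sub>M i\<in>UNIV. measure_pmf (coin Z)) (measure_pmf (coin Z)) (\<lambda>s. s n) = user_dist (two_task_instance m Z p q)" for n :: nat
    using stream.PiM_component[of n] by (simp add: two_task_instance_def)
  \<comment> \<open>The factors are discrete, but the pair carries the product sigma-algebra;
    measurability comes from projecting to the output, the only coordinate the reward reads.\<close>
  moreover have "(\<lambda>(t, y). reward (two_task_instance m Z p q) t y) \<in> borel_measurable (measure_pmf (coin Z) \<Otimes>\<^sub>M count_space UNIV)"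
  proof -
    have "(\<lambda>z. of_bool (snd z = 1)) \<in> borel_measurable (measure_pmf (coin Z) \<Otimes>\<^sub>M count_space (UNIV :: real set))"
      by (rule measurable_compose[OF measurable_snd, where g="\<lambda>y. of_bool (y = 1)"]) simp
    then show ?thesis
      by (simp only: two_task_instance_def split_beta' eval_instance.simps)
  qed
  moreover have "Measurable.pred (measure_pmf (coin Z) \<Otimes>\<^sub>M count_space UNIV) (\<lambda>(t, y). fails (two_task_instance m Z p q) t y)"
  proof -
    have "Measurable.pred (measure_pmf (coin Z) \<Otimes>\<^sub>M count_space (UNIV :: real set)) (\<lambda>z. fst z = 1)"
      by (rule measurable_compose[OF measurable_fst, where g="\<lambda>t. t = 1"]) simp
    then show ?thesis
      by (simp only: two_task_instance_def split_beta' eval_instance.simps)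
  qed
  moreover have "kernel (two_task_instance m Z p q) a \<in> measure_pmf (coin Z) \<rightarrow>\<^sub>M prob_algebra (count_space UNIV)" for a
    by (simp add: two_task_instance_def space_prob_algebra prob_space_measure_pmf)
  ultimately show ?thesis
    using Z unfolding valid_instance_def Let_def
    by (simp add: fail_mass_two_task stream.stationary_iid stream.ergodic_iid stream.beta_mixing_iid)
       (simp add: two_task_instance_def prob_space_measure_pmf pair.P.prob_space_axioms)
qed

end

section \<open>Reward laws and what the two instances share\<close>

lemma nn_integral_reward_law_two_task:
  assumes "g \<in> borel_measurable borel"
  shows "(\<integral>\<^sup>+y. g y \<partial>reward_law (two_task_instance m Z p q) a t) =
    (\<integral>\<^sup>+y. g (of_bool (y = 1)) \<partial>coin (if t = 1 then case a of Current \<Rightarrow> p | Candidate \<Rightarrow> q else 1))"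
  unfolding reward_law_def using assms
  by (subst nn_integral_distr) (simp_all add: two_task_instance_def)

text \<open>The records are built from the task law, the current agent's kernel and the failure
  marks, none of which involves \<open>q\<close>.\<close>

lemma data_law_two_task:
  "data_law TS OS m (two_task_instance m Z p q) = data_law TS OS m (two_task_instance m Z p q')"
  by (simp add: data_law_def two_task_instance_def cong: if_cong)

lemma same_except_candidate_on_failures_two_task:
  "same_except_candidate_on_failures TS OS m (two_task_instance m Z p q) (two_task_instance m Z p q')"
  unfolding same_except_candidate_on_failures_def
  by (simp add: data_law_two_task)
     (auto simp: two_task_instance_def fail_prob_def reward_law_def measure_pmf.prob_space)

theorem theorem5:
  fixes Z \<beta> u :: real and m :: nat
  assumes "0 < Z" and "Z < 1" and "\<beta> \<le> 1 / 8" and "0 < u" and "u \<le> Z / 2"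
  shows "\<exists>(TS :: real measure) (OS :: real measure)
            (I_imp :: (real, real) eval_instance) (I_non :: (real, real) eval_instance).
     valid_instance TS OS m I_imp \<and> valid_instance TS OS m I_non \<and>
     fail_mass I_imp = Z \<and> fail_mass I_non = Z \<and>
     1 - J_user I_imp Current = u \<and> 1 - J_user I_non Current = u \<and>
     same_except_candidate_on_failures TS OS m I_imp I_non \<and>
     J_user I_imp Candidate - J_user I_imp Current = u / 2 \<and> regression I_imp = 0 \<and>
     J_user I_non Candidate - J_user I_non Current = - (u / 2) \<and>
     (\<forall>\<pi>. valid_procedure TS OS m \<pi> \<longrightarrow> has_level TS OS m \<pi> \<beta> \<longrightarrow>
        \<P>(\<omega> in run_law TS OS m I_imp \<pi>. validates \<pi> \<omega>) \<ge> 1 / 2 \<longrightarrow>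
        (\<integral>\<^sup>+\<omega>. N_eval \<pi> \<omega> \<partial>run_law TS OS m I_non \<pi>) \<ge> ennreal (Z / (10 * u)))"
proof -
  \<comment> \<open>All reward is lost on the failure task, which has mass \<open>Z\<close>; a loss
    of \<open>u / Z\<close> there gives a total loss of \<open>u\<close>. The candidates lose
    \<open>1 / 2\<close> and \<open>3 / 2\<close> times as much, hence the gaps of plus and minus
    \<open>u / 2\<close>. The bound \<open>u \<le> Z / 2\<close> keeps even the largest loss on the
    task below 1.\<close>
  define p where "p = 1 - u / Z"
  define q_imp where "q_imp = 1 - u / (2 * Z)"
  define q_non where "q_non = 1 - 3 * u / (2 * Z)"
  have p: "0 \<le> p" "p \<le> 1" and q_imp: "0 \<le> q_imp" "q_imp \<le> 1" and q_non: "0 \<le> q_non" "q_non \<le> q_imp" "q_non \<le> 1"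
    and diff: "q_imp - q_non = u / Z"
    using assms by (auto simp: p_def q_imp_def q_non_def field_simps)
  let ?TS = "measure_pmf (coin Z)" and ?OS = "count_space UNIV :: real measure"
  let ?imp = "two_task_instance m Z p q_imp" and ?non = "two_task_instance m Z p q_non"
  note imp = assms(1,2) p q_imp and non = assms(1,2) p q_non(1,3)
  have J: "1 - J_user ?imp Current = u" "1 - J_user ?non Current = u"
      "J_user ?imp Candidate - J_user ?imp Current = u / 2"
      "J_user ?non Candidate - J_user ?non Current = - (u / 2)"
    unfolding J_user_two_task[OF imp] J_user_two_task[OF non]
    using assms by (simp_all add: p_def q_imp_def q_non_def field_simps)
  have "ennreal (Z / (10 * u)) \<le> (\<integral>\<^sup>+\<omega>. N_eval \<pi> \<omega> \<partial>run_law ?TS ?OS m ?non \<pi>)"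
    if \<pi>: "valid_procedure ?TS ?OS m \<pi>" and level: "has_level ?TS ?OS m \<pi> \<beta>"
      and power: "\<P>(\<omega> in run_law ?TS ?OS m ?imp \<pi>. validates \<pi> \<omega>) \<ge> 1 / 2" for \<pi>
  proof -
    let ?P = "\<lambda>I. {\<omega> \<in> space (run_law ?TS ?OS m I \<pi>). validates \<pi> \<omega>}"
    let ?N = "\<integral>\<^sup>+\<omega>. N_eval \<pi> \<omega> \<partial>run_law ?TS ?OS m ?non \<pi>"
    have finite: "emeasure (run_law ?TS ?OS m I \<pi>) A \<noteq> \<top>" if "valid_instance ?TS ?OS m I" for I A
      using procedure_run.emeasure_run_law_le_1[OF procedure_run.intro[OF that \<pi>], of A]
      by (auto simp: top_unique)
    \<comment> \<open>In the non-improving instance the comparison of the two values holds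
      identically, so the level bounds the whole probability of validating.\<close>
    have "measure (run_law ?TS ?OS m ?non \<pi>) (?P ?non) \<le> 1 / 8"
      using level valid_two_task[OF non] J(4) assms unfolding has_level_def by fastforce
    then have non_le: "emeasure (run_law ?TS ?OS m ?non \<pi>) (?P ?non) \<le> ennreal (1 / 8)"
      unfolding emeasure_eq_ennreal_measure[OF finite[OF valid_two_task[OF non]]] by (rule ennreal_leI)
    have "ennreal (1 / 2) \<le> ennreal (measure (run_law ?TS ?OS m ?imp \<pi>) (?P ?imp))"
      by (rule ennreal_leI) (rule power)
    also have "\<dots> = emeasure (run_law ?TS ?OS m ?imp \<pi>) (?P ?imp)"
      by (rule emeasure_eq_ennreal_measure[symmetric]) (rule finite[OF valid_two_task[OF imp]])
    also have "\<dots> \<le> emeasure (run_law ?TS ?OS m ?non \<pi>) (?P ?non) + ennreal (u / Z) * ?N"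
    proof (rule emeasure_validates_le_add_runs[OF valid_two_task[OF imp] valid_two_task[OF non] \<pi> data_law_two_task])
      fix a t and g :: "real \<Rightarrow> ennreal"
      assume "g \<in> borel_measurable borel" and "\<And>y. g y \<le> 1"
      then show "(\<integral>\<^sup>+y. g y \<partial>reward_law ?imp a t) \<le>
          (\<integral>\<^sup>+y. g y \<partial>reward_law ?non a t) + ennreal (u / Z) * of_bool (a = Candidate)"
        using nn_integral_coin_le[OF q_non(1,2) q_imp(2), of "\<lambda>y. g (of_bool (y = 1))"]
        by (cases a) (simp_all add: nn_integral_reward_law_two_task diff)
    qed
    also have "\<dots> \<le> ennreal (1 / 8) + ennreal (u / Z) * ?N"
      by (intro add_mono non_le) simp
    finally have bound: "ennreal (1 / 2) \<le> ennreal (1 / 8) + ennreal (u / Z) * ?N" .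
    show ?thesis
    \<comment> \<open>An infinite expectation satisfies the claim outright. For a finite one,
      \<open>1 / 2 - 1 / 8 = 3 / 8\<close> gives \<open>n \<ge> 3 * Z / (8 * u)\<close>, which
      exceeds the claimed \<open>Z / (10 * u)\<close>.\<close>
    proof (cases ?N)
      case (real n)
      have "ennreal (1 / 8) + ennreal (u / Z) * ?N = ennreal (1 / 8 + u / Z * n)"
        unfolding real(2) using real(1) assms by (subst ennreal_plus) (auto simp: ennreal_mult[symmetric])
      with bound have "ennreal (1 / 2) \<le> ennreal (1 / 8 + u / Z * n)"
        by (simp only:)
      then have "1 / 2 \<le> 1 / 8 + u / Z * n"
        using real assms by (subst (asm) ennreal_le_iff) auto
      then have "3 / 8 * Z \<le> u * n"
        using assms by (simp add: field_simps)
      then have "Z / (10 * u) \<le> n"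
        using assms by (simp add: field_simps)
      then show ?thesis
        unfolding real(2) by (rule ennreal_leI)
    qed simp
  qed
  then show ?thesis
    using valid_two_task[OF imp] valid_two_task[OF non] J
      fail_mass_two_task[OF imp] fail_mass_two_task[OF non] regression_two_task[OF imp]
      same_except_candidate_on_failures_two_task
    by blast
qed

end
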